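(* Let $G$ be a graph with $n$ vertices and suppose that $s\geq 1$ is the largest integer such that $s\text{-ord-match}(G)=\text{ord-match}(G)$, where $s\text{-ord-match}(G)$ is the $s$-ordered matching number of $G$ and $\text{ord-match}(G)$ is the ordered matching number of $G$. For each integer $k\geq 1$, let $G_k$ be the graph, built from $G$, defined in the context, and let $I(G_k)$ be its edge ideal, in the polynomial ring over a field $\mathbb{K}$ whose variables are the vertices of $G_k$. (i) If $s=1$, then for every integer $k\geq 2\,\text{ord-match}(G)-1$, we have $$\operatorname{reg}(I(G_k))=\text{ind-match}(G_k)+1=\text{ord-match}(G)+1.$$ (ii) If $s\geq 2$, then for every integer $k\geq 2\,\text{ord-match}(G)-2s+2$, we have $$\operatorname{reg}(I(G_k))=\text{ind-match}(G_k)+1=\text{ord-match}(G)+1.$$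
   Context: Graphs are finite and simple. A subset of $V(G)$ is independent if no edge of $G$ joins two of its elements. A matching in $G$ is a set of pairwise disjoint edges. An induced matching is a matching that, viewed as a subgraph, is an induced subgraph (i.e. the only edges of the graph among the endpoints of the matching edges are the matching edges themselves). The induced matching number $\text{ind-match}(H)$ of a graph $H$ is the maximum cardinality of an induced matching of $H$. Ordered matching: a nonempty matching $M=\{\{a_i,b_i\}\mid 1\leq i\leq r\}$ of $G$ (with the edges indexed and the endpoints named as shown) is an ordered matching of $G$ if (1) $\{a_1,\ldots,a_r\}$ is an independent subset of $G$; and (2) $\{a_i,b_j\}\in E(G)$ implies $i\leq j$. The ordered matching number $\text{ord-match}(G)$ is the maximum of $|M|$ over all ordered matchings $M$ of $G$ (so it presupposes that $G$ has at least one edge). $s$-ordered matching: for an integer $s\geq 1$, a nonempty matching $M=\{\{a_i,b_i\}\mid 1\leq i\leq r\}$ of $G$ is an $s$-ordered matching of $G$ if (1) $r\geq s$; (2) $\{a_1,\ldots,a_r\}$ is an independent subset of $G$; and (3) $\{a_i,b_j\}\in E(G)$ implies that either $i=j$ or $i\leq j-s$. The $s$-ordered matching number $s\text{-ord-match}(G)$ is the maximum of $|M|$ over all $s$-ordered matchings $M$ of $G$, and it is $-\infty$ if $G$ has no $s$-ordered matching. (A $1$-ordered matching is the same as an ordered matching.) The graph $G_k$: if $V(G)=\{x_1,\ldots,x_n\}$ and $k\geq 1$ is an integer, then $G_k$ is the graph with vertex set $V(G_k)=\{x_{i,p}\mid 1\leq i\leq n,\ 1\leq p\leq k\}$ and edge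 set $E(G_k)=\{\{x_{i,p},x_{j,q}\}\mid \{x_i,x_j\}\in E(G)\text{ and } p+q\leq k+1\}$. The edge ideal $I(H)$ of a graph $H$ is the ideal, in the polynomial ring $R$ over $\mathbb{K}$ whose variables are the vertices of $H$, generated by the monomials $uv$ with $\{u,v\}\in E(H)$. For a finitely generated graded $R$-module $M$, the Castelnuovo--Mumford regularity is $\operatorname{reg}(M)=\max\{j-i\mid \operatorname{Tor}_i^R(\mathbb{K},M)_j\neq 0\}$. *)

theory Defs
  imports
    "HOL-Algebra.Ideal"
    "HOL-Library.Poly_Mapping"
    "HOL-Library.Extended_Real"
begin

section \<open>Graphs, matchings and their invariants\<close>

definition fin_simple_graph :: "'v set \<Rightarrow> 'v set set \<Rightarrow> bool" where
  "fin_simple_graph V E \<longleftrightarrow> finite V \<and> (\<forall>e\<in>E. e \<subseteq> V \<and> card e = 2)"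

definition independent :: "'v set set \<Rightarrow> 'v set \<Rightarrow> bool" where
  "independent E A \<longleftrightarrow> (\<forall>x\<in>A. \<forall>y\<in>A. {x, y} \<notin> E)"

definition matching :: "'v set set \<Rightarrow> 'v set set \<Rightarrow> bool" where
  "matching E M \<longleftrightarrow> M \<subseteq> E \<and> (\<forall>e\<in>M. \<forall>f\<in>M. e \<noteq> f \<longrightarrow> e \<inter> f = {})"

definition induced_matching :: "'v set set \<Rightarrow> 'v set set \<Rightarrow> bool" where
  "induced_matching E M \<longleftrightarrow> matching E M \<and> (\<forall>e\<in>E. e \<subseteq> \<Union>M \<longrightarrow> e \<in> M)"

definition ind_match :: "'v set set \<Rightarrow> nat" where
  "ind_match E = Max {card M | M. induced_matching E M}"

definition ordered_matching :: "'v set set \<Rightarrow> 'v set set \<Rightarrow> bool" where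
  "ordered_matching E M \<longleftrightarrow> matching E M \<and> M \<noteq> {} \<and>
     (\<exists>r a b. r = card M \<and> M = {{a i, b i} | i. i \<in> {1..r}} \<and>
        independent E (a ` {1..r}) \<and>
        (\<forall>i\<in>{1..r}. \<forall>j\<in>{1..r}. {a i, b j} \<in> E \<longrightarrow> i \<le> j))"

(* Only meaningful when E is nonempty: a graph without edges has no ordered matching. *)
definition ord_match :: "'v set set \<Rightarrow> nat" where
  "ord_match E = Max {card M | M. ordered_matching E M}"

definition s_ordered_matching :: "nat \<Rightarrow> 'v set set \<Rightarrow> 'v set set \<Rightarrow> bool" where
  "s_ordered_matching s E M \<longleftrightarrow> matching E M \<and> M \<noteq> {} \<and>
     (\<exists>r a b. r = card M \<and> M = {{a i, b i} | i. i \<in> {1..r}} \<and>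
        r \<ge> s \<and>
        independent E (a ` {1..r}) \<and>
        (\<forall>i\<in>{1..r}. \<forall>j\<in>{1..r}. {a i, b j} \<in> E \<longrightarrow> i = j \<or> int i \<le> int j - int s))"

definition s_ord_match :: "nat \<Rightarrow> 'v set set \<Rightarrow> ereal" where
  "s_ord_match s E =
     (if \<exists>M. s_ordered_matching s E M
      then ereal (real (Max {card M | M. s_ordered_matching s E M}))
      else - \<infinity>)"

definition Gk_verts :: "nat \<Rightarrow> 'v set \<Rightarrow> ('v \<times> nat) set" where
  "Gk_verts k V = V \<times> {1..k}"

definition Gk_edges :: "nat \<Rightarrow> 'v set set \<Rightarrow> ('v \<times> nat) set set" where
  "Gk_edges k E = {{(x, p), (y, q)} | x y p q.
     {x, y} \<in> E \<and> p \<in> {1..k} \<and> q \<in> {1..k} \<and> p + q \<le> k + 1}"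


section \<open>Polynomial rings and edge ideals\<close>

type_synonym ('x, 'k) mpoly = "('x \<Rightarrow>\<^sub>0 nat) \<Rightarrow>\<^sub>0 'k"

(* The polynomials in which only variables from X occur. *)
definition polys :: "'x set \<Rightarrow> ('x, 'k::zero) mpoly set" where
  "polys X = {p. \<forall>m\<in>Poly_Mapping.keys p. Poly_Mapping.keys m \<subseteq> X}"

definition poly_ring :: "'x set \<Rightarrow> ('x, 'k::field) mpoly ring" where
  "poly_ring X = \<lparr>carrier = polys X, monoid.mult = (*), one = 1, zero = 0, add = (+)\<rparr>"

definition var :: "'x \<Rightarrow> ('x, 'k::field) mpoly" where
  "var x = Poly_Mapping.single (Poly_Mapping.single x 1) 1"

definition mdeg :: "('x \<Rightarrow>\<^sub>0 nat) \<Rightarrow> nat" where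
  "mdeg m = (\<Sum>x\<in>Poly_Mapping.keys m. Poly_Mapping.lookup m x)"

(* The zero polynomial is homogeneous of every degree d, including d < 0. *)
definition homogeneous :: "int \<Rightarrow> ('x, 'k::zero) mpoly \<Rightarrow> bool" where
  "homogeneous d p \<longleftrightarrow> (\<forall>m\<in>Poly_Mapping.keys p. int (mdeg m) = d)"

definition const_coeff :: "('x, 'k::zero) mpoly \<Rightarrow> 'k" where
  "const_coeff p = Poly_Mapping.lookup p 0"

definition edge_ideal :: "'x set \<Rightarrow> 'x set set \<Rightarrow> ('x, 'k::field) mpoly set" where
  "edge_ideal X E = genideal (poly_ring X) {var u * var v | u v. {u, v} \<in> E}"


section \<open>Tor and Castelnuovo-Mumford regularity\<close>

text \<open>
  Throughout, R is the standard graded ring \<open>polys X\<close> over the field \<open>'k\<close>. A graded R-module is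
  given by its scalar multiplication together with the family \<open>Mg\<close> of its homogeneous components:
  \<open>Mg d\<close> is the component of degree \<open>d\<close>.

  Tor is computed by its usual definition: take a graded free resolution F of \<open>\<K>\<close> by finitely
  generated modules, tensor it with M and take homology.  The module in homological degree i is
  the direct sum of the R(-shift i b) for b < rank i, so its tensor product with M is the direct
  sum of the M(-shift i b).
\<close>

(* dmat C i is the matrix of the differential from degree i + 1 to degree i: it sends the basis
   element b to the sum of the dmat C i b c times the basis element c.
   aug C b is the image in the field of the basis element b in homological degree 0. *)
record (overloaded) ('x, 'k) free_complex =
  rank :: "nat \<Rightarrow> nat"
  shift :: "nat \<Rightarrow> nat \<Rightarrow> int"
  dmat :: "nat \<Rightarrow> nat \<Rightarrow> nat \<Rightarrow> ('x, 'k) mpoly"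
  aug :: "nat \<Rightarrow> 'k"

(* The degree j part of the tensor product of C, in homological degree i, with M. *)
definition chains ::
  "('x, 'k) free_complex \<Rightarrow> (int \<Rightarrow> 'm::ab_group_add set) \<Rightarrow> nat \<Rightarrow> int \<Rightarrow> (nat \<Rightarrow> 'm) set" where
  "chains C Mg i j =
     {f. (\<forall>b<rank C i. f b \<in> Mg (j - shift C i b)) \<and> (\<forall>b\<ge>rank C i. f b = 0)}"

definition bd ::
  "('x, 'k) free_complex \<Rightarrow> (('x, 'k) mpoly \<Rightarrow> 'm \<Rightarrow> 'm::ab_group_add) \<Rightarrow> nat
     \<Rightarrow> (nat \<Rightarrow> 'm) \<Rightarrow> (nat \<Rightarrow> 'm)" where
  "bd C smul i f =
     (\<lambda>c. if c < rank C i then \<Sum>b<rank C (Suc i). smul (dmat C i b c) (f b) else 0)"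

definition cycles ::
  "('x, 'k) free_complex \<Rightarrow> (('x, 'k) mpoly \<Rightarrow> 'm \<Rightarrow> 'm::ab_group_add) \<Rightarrow> (int \<Rightarrow> 'm set)
     \<Rightarrow> nat \<Rightarrow> int \<Rightarrow> (nat \<Rightarrow> 'm) set" where
  "cycles C smul Mg i j =
     (case i of 0 \<Rightarrow> chains C Mg 0 j
      | Suc i' \<Rightarrow> {f \<in> chains C Mg i j. bd C smul i' f = (\<lambda>_. 0)})"

definition boundaries ::
  "('x, 'k) free_complex \<Rightarrow> (('x, 'k) mpoly \<Rightarrow> 'm \<Rightarrow> 'm::ab_group_add) \<Rightarrow> (int \<Rightarrow> 'm set)
     \<Rightarrow> nat \<Rightarrow> int \<Rightarrow> (nat \<Rightarrow> 'm) set" where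
  "boundaries C smul Mg i j = bd C smul i ` chains C Mg (Suc i) j"

definition R_comp :: "'x set \<Rightarrow> int \<Rightarrow> ('x, 'k::field) mpoly set" where
  "R_comp X d = {p \<in> polys X. homogeneous d p}"

(* The field as the R-module R/(variables), concentrated in degree 0. *)
definition K_comp :: "int \<Rightarrow> 'k::field set" where
  "K_comp d = (if d = 0 then UNIV else {0})"

definition K_smul :: "('x, 'k::field) mpoly \<Rightarrow> 'k \<Rightarrow> 'k" where
  "K_smul p c = const_coeff p * c"

definition augmentation :: "('x, 'k::field) free_complex \<Rightarrow> (nat \<Rightarrow> ('x, 'k) mpoly) \<Rightarrow> 'k" where
  "augmentation C f = (\<Sum>b<rank C 0. K_smul (f b) (aug C b))"

(* Exactness of ... -> F_1 -> F_0 -> K -> 0 is stated in each degree j. *)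
definition graded_free_resolution_of_K :: "'x set \<Rightarrow> ('x, 'k::field) free_complex \<Rightarrow> bool" where
  "graded_free_resolution_of_K X C \<longleftrightarrow>
     (\<forall>i. \<forall>b<rank C (Suc i). \<forall>c<rank C i.
        dmat C i b c \<in> R_comp X (shift C (Suc i) b - shift C i c)) \<and>
     (\<forall>b<rank C 0. aug C b \<in> K_comp (shift C 0 b)) \<and>
     (\<forall>i j. cycles C (*) (R_comp X) (Suc i) j = boundaries C (*) (R_comp X) (Suc i) j) \<and>
     (\<forall>j. {f \<in> chains C (R_comp X) 0 j. augmentation C f = 0} = boundaries C (*) (R_comp X) 0 j) \<and>
     (\<forall>j. augmentation C ` chains C (R_comp X) 0 j = K_comp j)"

(* Tor_i(K, M)_j is nonzero.  Up to isomorphism Tor does not depend on the resolution, so that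
   the existential quantifier over resolutions could equally be a universal one. *)
definition Tor_nonzero ::
  "'x set \<Rightarrow> (('x, 'k::field) mpoly \<Rightarrow> 'm \<Rightarrow> 'm::ab_group_add) \<Rightarrow> (int \<Rightarrow> 'm set)
     \<Rightarrow> nat \<Rightarrow> int \<Rightarrow> bool" where
  "Tor_nonzero X smul Mg i j \<longleftrightarrow>
     (\<exists>C. graded_free_resolution_of_K X C \<and> cycles C smul Mg i j \<noteq> boundaries C smul Mg i j)"

definition regularity ::
  "'x set \<Rightarrow> (('x, 'k::field) mpoly \<Rightarrow> 'm \<Rightarrow> 'm::ab_group_add) \<Rightarrow> (int \<Rightarrow> 'm set) \<Rightarrow> int" where
  "regularity X smul Mg = Max {j - int i | i j. Tor_nonzero X smul Mg i j}"

definition ideal_reg :: "'x set \<Rightarrow> ('x, 'k::field) mpoly set \<Rightarrow> int" where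
  "ideal_reg X I = regularity X (*) (\<lambda>d. {p \<in> I. homogeneous d p})"

end

theory Submission
  imports Defs
begin

text \<open>
  All ideals involved are spanned by sets of monomials, so that sums and intersections become
  unions and intersections of sets, and Mayer--Vietoris sequences can be run for any fixed graded
  free resolution of the field.

  Upper bound. If \<open>v\<close> is a vertex of \<open>H\<close>, then \<open>I(H) : v = I(H - N[v]) + (N(v))\<close> and
  \<open>I(H) + (v) = I(H - v) + (v)\<close>, hence \<open>reg I(H) \<le> max (reg I(H - N[v]) + 1) (reg I(H - v))\<close>. Applied
  to \<open>G\<^sub>k\<close>, always choosing a non-isolated vertex \<open>v = x\<^bsub>i,p\<^esub>\<close> with \<open>p\<close> least, the vertices whose
  neighbourhood is deleted form, together with a neighbour of each, an ordered matching of \<open>G\<close> listed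
  backwards. So \<open>reg I(G\<^sub>k) \<le> ord-match(G) + 1\<close> for every \<open>k\<close>.

  Lower bound. An induced matching of size \<open>r\<close> forces \<open>Tor\<^bsub>r - 1\<^esub>(I)\<^bsub>2 r\<^esub> \<noteq> 0\<close>: this is
  seen edge by edge over the vertices of the matching, and survives the adjunction of the other
  vertices, which replaces the resolution by the cone of multiplication by the new variable. Finally
  an \<open>s\<close>-ordered matching of size \<open>r\<close> becomes an induced matching of \<open>G\<^sub>k\<close> by lifting \<open>b\<^sub>i\<close> to
  the level \<open>k - r + max s i\<close> and \<open>a\<^sub>i\<close> to the complementary level.
\<close>


subsection \<open>Monomials and polynomials\<close>

abbreviation "lookup \<equiv> Poly_Mapping.lookup"
abbreviation "keys \<equiv> Poly_Mapping.keys"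
abbreviation "single \<equiv> Poly_Mapping.single"

lemma mdeg_superset:
  assumes "finite A" "keys m \<subseteq> A"
  shows "mdeg m = (\<Sum>x\<in>A. lookup m x)"
  unfolding mdeg_def
  by (rule sum.mono_neutral_left) (use assms in \<open>auto simp: in_keys_iff\<close>)

lemma keys_add_nat: "keys ((m::'x \<Rightarrow>\<^sub>0 nat) + t) = keys m \<union> keys t"
  by (auto simp: in_keys_iff lookup_add)

lemma mdeg_add: "mdeg (m + t) = mdeg m + mdeg t"
proof -
  have "mdeg (m + t) = (\<Sum>x\<in>keys m \<union> keys t. lookup (m + t) x)"
    by (rule mdeg_superset) (auto simp: keys_add_nat)
  also have "\<dots> = mdeg m + mdeg t"
    by (subst (1 2) mdeg_superset[where A = "keys m \<union> keys t"]) (auto simp: lookup_add sum.distrib)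
  finally show ?thesis .
qed

lemma mdeg_zero [simp]: "mdeg 0 = 0"
  by (simp add: mdeg_def)

definition monoms :: "'x set \<Rightarrow> ('x \<Rightarrow>\<^sub>0 nat) set" where
  "monoms X = {m. keys m \<subseteq> X}"

text \<open>These are the exponent sets of the monomial ideals of \<open>polys X\<close>.\<close>

definition upset :: "'x set \<Rightarrow> ('x \<Rightarrow>\<^sub>0 nat) set \<Rightarrow> bool" where
  "upset X U \<longleftrightarrow> U \<subseteq> monoms X \<and> (\<forall>m\<in>U. \<forall>t\<in>monoms X. m + t \<in> U)"

text \<open>A graded component of the span of the monomials in \<open>U\<close>. As membership is
  tested term by term, sums and intersections of ideals are read off from unions and intersections
  of exponent sets.\<close>

definition mcomp :: "('x \<Rightarrow>\<^sub>0 nat) set \<Rightarrow> int \<Rightarrow> ('x, 'k::zero) mpoly set" where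
  "mcomp U d = {p. keys p \<subseteq> {m \<in> U. int (mdeg m) = d}}"

lemma mcomp_homogeneous: "mcomp U d = {p \<in> {p. keys p \<subseteq> U}. homogeneous d p}"
  by (auto simp: mcomp_def homogeneous_def)

lemma R_comp_eq: "R_comp X = mcomp (monoms X)"
  by (auto simp: R_comp_def mcomp_def homogeneous_def polys_def monoms_def fun_eq_iff)

lemma upset_monoms: "upset X (monoms X)"
  by (auto simp: upset_def monoms_def keys_add_nat)

lemma keys_uminus_ring: "keys (- p :: 'a \<Rightarrow>\<^sub>0 'b::ab_group_add) = keys p"
  by (auto simp: in_keys_iff)

lemma keys_diff_ring: "keys (p - q :: 'a \<Rightarrow>\<^sub>0 'b::ab_group_add) \<subseteq> keys p \<union> keys q"
  by (auto simp: in_keys_iff lookup_minus)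

lemma mcomp_zero [simp]: "0 \<in> mcomp U d"
  by (simp add: mcomp_def)

lemma mcomp_mono: "U \<subseteq> V \<Longrightarrow> p \<in> mcomp U d \<Longrightarrow> p \<in> mcomp V d"
  by (auto simp: mcomp_def)

lemma mcomp_add: "p \<in> mcomp U d \<Longrightarrow> q \<in> mcomp U d \<Longrightarrow> p + q \<in> mcomp U d"
  for p :: "('x, 'k::ab_group_add) mpoly"
  unfolding mcomp_def using keys_add[of p q] by blast

lemma mcomp_diff: "p \<in> mcomp U d \<Longrightarrow> q \<in> mcomp U d \<Longrightarrow> p - q \<in> mcomp U d"
  for p :: "('x, 'k::ab_group_add) mpoly"
  unfolding mcomp_def using keys_diff_ring[of p q] by blast

lemma mcomp_uminus: "p \<in> mcomp U d \<Longrightarrow> - p \<in> mcomp U d"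
  for p :: "('x, 'k::ab_group_add) mpoly"
  by (simp add: mcomp_def keys_uminus_ring)

lemma mcomp_sum: "(\<And>b. b \<in> B \<Longrightarrow> f b \<in> mcomp U d) \<Longrightarrow> sum f B \<in> mcomp U d"
  for f :: "'b \<Rightarrow> ('x, 'k::ab_group_add) mpoly"
  by (induction B rule: infinite_finite_induct) (auto intro: mcomp_add)

lemma mcomp_Int: "p \<in> mcomp U d \<Longrightarrow> p \<in> mcomp V d \<Longrightarrow> p \<in> mcomp (U \<inter> V) d"
  by (auto simp: mcomp_def)

lemma mcomp_mult:
  fixes p q :: "('x, 'k::field) mpoly"
  assumes "upset X U" "p \<in> mcomp (monoms X) a" "q \<in> mcomp U b"
  shows "p * q \<in> mcomp U (a + b)"
proof -
  have "m \<in> U \<and> int (mdeg m) = a + b" if "m \<in> keys (p * q)" for m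
  proof -
    have "m \<in> {a + b |a b. a \<in> keys p \<and> b \<in> keys q}"
      using that keys_mult[of p q] by blast
    then obtain m1 m2 where m: "m = m1 + m2" "m1 \<in> keys p" "m2 \<in> keys q"
      by blast
    then have "m1 \<in> monoms X" "m2 \<in> U" "int (mdeg m1) = a" "int (mdeg m2) = b"
      using assms by (auto simp: mcomp_def)
    then show ?thesis using assms(1) m(1) by (auto simp: upset_def mdeg_add add.commute)
  qed
  then show ?thesis by (auto simp: mcomp_def)
qed

section \<open>Truncation to a set of terms and division by a monomial\<close>

definition prestr :: "'a set \<Rightarrow> ('a \<Rightarrow>\<^sub>0 'b::zero) \<Rightarrow> 'a \<Rightarrow>\<^sub>0 'b" where
  "prestr S p = Abs_poly_mapping (\<lambda>m. if m \<in> S then lookup p m else 0)"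

lemma lookup_prestr: "lookup (prestr S p) m = (if m \<in> S then lookup p m else 0)"
proof -
  have "finite {m. (if m \<in> S then lookup p m else 0) \<noteq> 0}"
    by (rule finite_subset[of _ "keys p"]) (auto simp: in_keys_iff)
  then show ?thesis by (simp add: prestr_def)
qed

lemma keys_prestr: "keys (prestr S p) = keys p \<inter> S"
  by (auto simp: in_keys_iff lookup_prestr split: if_splits)

lemma prestr_add: "prestr S (p + q) = prestr S p + prestr S (q :: 'a \<Rightarrow>\<^sub>0 'b::monoid_add)"
  by (rule poly_mapping_eqI) (simp add: lookup_prestr lookup_add)

lemma prestr_zero [simp]: "prestr S 0 = 0"
  by (rule poly_mapping_eqI) (simp add: lookup_prestr)

lemma prestr_sum: "prestr S (sum f B) = (\<Sum>b\<in>B. prestr S (f b :: 'a \<Rightarrow>\<^sub>0 'b::comm_monoid_add))"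
  by (induction B rule: infinite_finite_induct) (auto simp: prestr_add)

lemma prestr_ident: "keys p \<subseteq> S \<Longrightarrow> prestr S p = p"
  by (rule poly_mapping_eqI) (auto simp: lookup_prestr in_keys_iff)

abbreviation mon :: "('x \<Rightarrow>\<^sub>0 nat) \<Rightarrow> ('x, 'k::field) mpoly" where
  "mon m \<equiv> single m 1"

lemma lookup_mon_mult: "lookup (mon m * p) (m + t) = lookup p t"
  by (simp add: lookup_mult lookup_single when_mult)

lemma keys_mon_mult: "keys (mon m * p) = (+) m ` keys p"
proof
  show "keys (mon m * p) \<subseteq> (+) m ` keys p"
    using keys_mult[of "mon m" p] by auto
  show "(+) m ` keys p \<subseteq> keys (mon m * p)"
    by (auto simp: in_keys_iff lookup_mon_mult)
qed

text \<open>Terms that are not multiples of the monomial are dropped, which makes this a total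
  additive left inverse of multiplication by \<open>mon m\<close>.\<close>

definition mdiv :: "('x \<Rightarrow>\<^sub>0 nat) \<Rightarrow> ('x, 'k::field) mpoly \<Rightarrow> ('x, 'k) mpoly" where
  "mdiv m p = Poly_Mapping.map_key ((+) m) p"

lemma lookup_mdiv: "lookup (mdiv m p) t = lookup p (m + t)"
  by (simp add: mdiv_def map_key.rep_eq)

lemma mdiv_mon_mult: "mdiv m (mon m * p) = p"
  by (rule poly_mapping_eqI) (simp add: lookup_mdiv lookup_mon_mult)

lemma mdiv_add: "mdiv m (p + q) = mdiv m p + mdiv m q"
  by (rule poly_mapping_eqI) (simp add: lookup_mdiv lookup_add)

lemma mdiv_zero [simp]: "mdiv m 0 = 0"
  by (rule poly_mapping_eqI) (simp add: lookup_mdiv)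

lemma mon_mult_mdiv:
  assumes "keys p \<subseteq> range ((+) m)"
  shows "mon m * mdiv m p = p"
proof (rule poly_mapping_eqI)
  fix t
  show "lookup (mon m * mdiv m p) t = lookup p t"
  proof (cases "t \<in> range ((+) m)")
    case True
    then show ?thesis by (auto simp: lookup_mon_mult lookup_mdiv)
  next
    case False
    then have "t \<notin> keys p" "t \<notin> keys (mon m * mdiv m p)"
      using assms by (auto simp: keys_mon_mult)
    then show ?thesis by (simp add: in_keys_iff)
  qed
qed

lemma mon_mult_cancel: "mon m * p = mon m * q \<Longrightarrow> p = q"
  by (metis mdiv_mon_mult)

lemma mcomp_shift_iff: "mon m * p \<in> mcomp ((+) m ` U) (d + int (mdeg m)) \<longleftrightarrow> p \<in> mcomp U d"
  by (auto simp: mcomp_def keys_mon_mult mdeg_add)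

lemma mcomp_shift_ex:
  assumes "p \<in> mcomp ((+) m ` U) d"
  shows "\<exists>q. q \<in> mcomp U (d - int (mdeg m)) \<and> p = mon m * q"
proof -
  have eq: "p = mon m * mdiv m p"
    using assms by (intro mon_mult_mdiv[symmetric]) (auto simp: mcomp_def)
  then have "mon m * mdiv m p \<in> mcomp ((+) m ` U) (d - int (mdeg m) + int (mdeg m))"
    using assms by simp
  then show ?thesis using eq mcomp_shift_iff by blast
qed

subsection \<open>Homology\<close>

abbreviation bdR :: "('x, 'k::field) free_complex \<Rightarrow> nat \<Rightarrow> (nat \<Rightarrow> ('x, 'k) mpoly) \<Rightarrow> nat \<Rightarrow> ('x, 'k) mpoly" where
  "bdR C i f \<equiv> bd C (*) i f"

lemma bdR_add: "bdR C i (\<lambda>b. f b + g b) = (\<lambda>c. bdR C i f c + bdR C i g c)"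
  by (auto simp: bd_def fun_eq_iff algebra_simps sum.distrib)

lemma bdR_diff: "bdR C i (\<lambda>b. f b - g b) = (\<lambda>c. bdR C i f c - bdR C i g c)"
  by (auto simp: bd_def fun_eq_iff algebra_simps sum_subtractf)

lemma bdR_uminus: "bdR C i (\<lambda>b. - f b) = (\<lambda>c. - bdR C i f c)"
  by (auto simp: bd_def fun_eq_iff sum_negf)

lemma bdR_mult: "bdR C i (\<lambda>b. p * f b) = (\<lambda>c. p * bdR C i f c)"
  by (auto simp: bd_def fun_eq_iff sum_distrib_left mult.left_commute intro!: sum.cong)

lemma bdR_zero [simp]: "bdR C i (\<lambda>b. 0) = (\<lambda>c. 0)"
  by (auto simp: bd_def fun_eq_iff)

text \<open>Vanishing, in homological degree \<open>i\<close> and internal degree \<open>j\<close>, of Tor of the ideal spanned by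
  the monomials in \<open>U\<close>.\<close>

definition van :: "('x, 'k::field) free_complex \<Rightarrow> ('x \<Rightarrow>\<^sub>0 nat) set \<Rightarrow> nat \<Rightarrow> int \<Rightarrow> bool" where
  "van C U i j \<longleftrightarrow> cycles C (*) (mcomp U) i j \<subseteq> boundaries C (*) (mcomp U) i j"

lemma chains_zero [simp]: "(\<lambda>_. 0) \<in> chains C (mcomp U) i j"
  by (auto simp: chains_def)

lemma chains_mono: "U \<subseteq> V \<Longrightarrow> f \<in> chains C (mcomp U) i j \<Longrightarrow> f \<in> chains C (mcomp V) i j"
  by (auto simp: chains_def intro: mcomp_mono)

lemma chains_add:
  "f \<in> chains C (mcomp U) i j \<Longrightarrow> g \<in> chains C (mcomp U) i j
    \<Longrightarrow> (\<lambda>b. f b + g b :: ('x, 'k::field) mpoly) \<in> chains C (mcomp U) i j"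
  by (auto simp: chains_def intro: mcomp_add)

lemma chains_diff:
  "f \<in> chains C (mcomp U) i j \<Longrightarrow> g \<in> chains C (mcomp U) i j
    \<Longrightarrow> (\<lambda>b. f b - g b :: ('x, 'k::field) mpoly) \<in> chains C (mcomp U) i j"
  by (auto simp: chains_def intro: mcomp_diff)

lemma chains_uminus:
  "f \<in> chains C (mcomp U) i j \<Longrightarrow> (\<lambda>b. - f b :: ('x, 'k::field) mpoly) \<in> chains C (mcomp U) i j"
  by (auto simp: chains_def intro: mcomp_uminus)

lemma chains_Int:
  "f \<in> chains C (mcomp U) i j \<Longrightarrow> f \<in> chains C (mcomp V) i j \<Longrightarrow> f \<in> chains C (mcomp (U \<inter> V)) i j"
  by (auto simp: chains_def intro: mcomp_Int)

text \<open>Each term of \<open>f\<close> lies in \<open>U\<close> or in \<open>V\<close>: those in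
  \<open>U\<close> form the first summand, the others the second. This is the surjection behind the
  Mayer-Vietoris sequences.\<close>

lemma chains_Un_split:
  fixes f :: "nat \<Rightarrow> ('x, 'k::field) mpoly"
  assumes "f \<in> chains C (mcomp (U \<union> V)) i j"
  obtains g h where "g \<in> chains C (mcomp U) i j" "h \<in> chains C (mcomp V) i j" "f = (\<lambda>b. g b + h b)"
proof
  show "(\<lambda>b. prestr U (f b)) \<in> chains C (mcomp U) i j"
    "(\<lambda>b. prestr (- U) (f b)) \<in> chains C (mcomp V) i j"
    using assms by (auto simp: chains_def mcomp_def keys_prestr)
  show "f = (\<lambda>b. prestr U (f b) + prestr (- U) (f b))"
    by (rule ext, rule poly_mapping_eqI) (simp add: lookup_add lookup_prestr)
qed

lemma chains_shift:
  "f \<in> chains C (mcomp U) i j \<Longrightarrow>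
    (\<lambda>b. mon m * f b) \<in> chains C (mcomp ((+) m ` U)) i (j + int (mdeg m))"
  unfolding chains_def using mcomp_shift_iff[of m "f b" U "j - shift C i b" for b]
  by (simp add: diff_add_eq)

lemma chains_shift_ex:
  fixes f :: "nat \<Rightarrow> ('x, 'k::field) mpoly"
  assumes "f \<in> chains C (mcomp ((+) m ` U)) i j"
  obtains g where "g \<in> chains C (mcomp U) i (j - int (mdeg m))" "f = (\<lambda>b. mon m * g b)"
proof -
  have "\<forall>b. \<exists>q. (b < rank C i \<longrightarrow> q \<in> mcomp U (j - shift C i b - int (mdeg m))) \<and>
      (b \<ge> rank C i \<longrightarrow> q = 0) \<and> f b = mon m * q"
  proof
    fix b
    show "\<exists>q. (b < rank C i \<longrightarrow> q \<in> mcomp U (j - shift C i b - int (mdeg m))) \<and>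
      (b \<ge> rank C i \<longrightarrow> q = 0) \<and> f b = mon m * q"
    proof (cases "b < rank C i")
      case True
      then have "f b \<in> mcomp ((+) m ` U) (j - shift C i b)"
        using assms by (auto simp: chains_def)
      from mcomp_shift_ex[OF this] show ?thesis using True by auto
    next
      case False
      then show ?thesis using assms by (auto simp: chains_def)
    qed
  qed
  then obtain g where g: "\<And>b. b < rank C i \<Longrightarrow> g b \<in> mcomp U (j - shift C i b - int (mdeg m))"
     "\<And>b. b \<ge> rank C i \<Longrightarrow> g b = 0" "\<And>b. f b = mon m * g b"
    by metis
  show thesis
  proof (rule that)
    show "g \<in> chains C (mcomp U) i (j - int (mdeg m))"
      using g(1,2) by (auto simp: chains_def algebra_simps)
    show "f = (\<lambda>b. mon m * g b)" using g(3) by blast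
  qed
qed

lemma chains_shift_iff:
  "(\<lambda>b. mon m * f b) \<in> chains C (mcomp ((+) m ` U)) i j \<longleftrightarrow> f \<in> chains C (mcomp U) i (j - int (mdeg m))"
proof
  assume "(\<lambda>b. mon m * f b) \<in> chains C (mcomp ((+) m ` U)) i j"
  then obtain g where g: "g \<in> chains C (mcomp U) i (j - int (mdeg m))"
      "(\<lambda>b. mon m * f b) = (\<lambda>b. mon m * g b)"
    by (rule chains_shift_ex)
  have "f = g"
    by (rule ext, rule mon_mult_cancel[of m]) (use g(2) in \<open>simp add: fun_eq_iff\<close>)
  with g(1) show "f \<in> chains C (mcomp U) i (j - int (mdeg m))" by simp
qed (use chains_shift[of f C U i "j - int (mdeg m)" m] in simp)

lemma cycles_iff:
  "f \<in> cycles C sm Mg i j \<longleftrightarrow>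
    f \<in> chains C Mg i j \<and> (\<forall>i'. i = Suc i' \<longrightarrow> bd C sm i' f = (\<lambda>_. 0))"
  by (auto simp: cycles_def split: nat.splits)

lemma vanD:
  assumes "van C U i j" "f \<in> chains C (mcomp U) i j" "\<And>i'. i = Suc i' \<Longrightarrow> bdR C i' f = (\<lambda>_. 0)"
  obtains g where "g \<in> chains C (mcomp U) (Suc i) j" "f = bdR C i g"
proof -
  have "f \<in> cycles C (*) (mcomp U) i j" using assms(2,3) by (simp add: cycles_iff)
  then show thesis using assms(1) that by (auto simp: van_def boundaries_def)
qed

lemma vanI:
  assumes "\<And>f. f \<in> chains C (mcomp U) i j \<Longrightarrow> (\<And>i'. i = Suc i' \<Longrightarrow> bdR C i' f = (\<lambda>_. 0)) \<Longrightarrow>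
    \<exists>g \<in> chains C (mcomp U) (Suc i) j. f = bdR C i g"
  shows "van C U i j"
  unfolding van_def boundaries_def
proof
  fix f assume "f \<in> cycles C (*) (mcomp U) i j"
  then show "f \<in> bdR C i ` chains C (mcomp U) (Suc i) j"
    using assms[of f] by (simp add: cycles_iff image_iff)
qed

section \<open>Mayer-Vietoris for a fixed resolution\<close>

locale resolution =
  fixes X :: "'x set" and C :: "('x, 'k::field) free_complex"
  assumes res: "graded_free_resolution_of_K X C"
begin

lemma dmat_R: "b < rank C (Suc i) \<Longrightarrow> c < rank C i \<Longrightarrow>
    dmat C i b c \<in> mcomp (monoms X) (shift C (Suc i) b - shift C i c)"
  using res by (auto simp: graded_free_resolution_of_K_def R_comp_eq)

lemma cycles_eq: "cycles C (*) (mcomp (monoms X)) (Suc i) j = boundaries C (*) (mcomp (monoms X)) (Suc i) j"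
  using res by (simp add: graded_free_resolution_of_K_def R_comp_eq)

lemma bd_chains:
  assumes "upset X U" "f \<in> chains C (mcomp U) (Suc i) j"
  shows "bdR C i f \<in> chains C (mcomp U) i j"
proof -
  have "dmat C i b c * f b \<in> mcomp U (j - shift C i c)" if "b < rank C (Suc i)" "c < rank C i" for b c
    using mcomp_mult[OF assms(1) dmat_R[OF that], of "f b" "j - shift C (Suc i) b"] assms(2) that
    by (auto simp: chains_def)
  then show ?thesis by (auto simp: chains_def bd_def intro: mcomp_sum)
qed

text \<open>Exactness is assumed for ring-valued chains only. Applying the differential twice to a
  basis element extracts an identity of matrices, from which \<open>bd_bd\<close> follows for
  arbitrary \<open>f\<close>.\<close>

lemma dmat_dmat:
  assumes b: "b < rank C (Suc (Suc i))" and d: "d < rank C i"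
  shows "(\<Sum>c<rank C (Suc i). dmat C i c d * dmat C (Suc i) b c) = 0"
proof -
  define e where "e = (\<lambda>b'. if b' = b then 1 else 0 :: ('x, 'k) mpoly)"
  have e: "e \<in> chains C (mcomp (monoms X)) (Suc (Suc i)) (shift C (Suc (Suc i)) b)"
    using b by (auto simp: e_def chains_def mcomp_def monoms_def)
  have bde: "bdR C (Suc i) e c = dmat C (Suc i) b c" if "c < rank C (Suc i)" for c
    using that b by (simp add: bd_def e_def if_distrib[where f = "\<lambda>x. _ * x"] sum.delta cong: if_cong)
  have "bdR C (Suc i) e \<in> cycles C (*) (mcomp (monoms X)) (Suc i) (shift C (Suc (Suc i)) b)"
    using e unfolding cycles_eq boundaries_def by (rule imageI)
  then have "bdR C i (bdR C (Suc i) e) d = 0"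
    by (simp add: cycles_iff)
  then show ?thesis using d bde by (simp add: bd_def)
qed

lemma bd_bd: "bdR C i (bdR C (Suc i) f) = (\<lambda>_. 0)"
proof
  fix d
  show "bdR C i (bdR C (Suc i) f) d = 0"
  proof (cases "d < rank C i")
    case True
    have "bdR C i (bdR C (Suc i) f) d
      = (\<Sum>c<rank C (Suc i). \<Sum>b<rank C (Suc (Suc i)). dmat C i c d * (dmat C (Suc i) b c * f b))"
      using True by (simp add: bd_def sum_distrib_left)
    also have "\<dots> = (\<Sum>b<rank C (Suc (Suc i)). (\<Sum>c<rank C (Suc i). dmat C i c d * dmat C (Suc i) b c) * f b)"
      by (subst sum.swap) (simp add: sum_distrib_right mult.assoc)
    also have "\<dots> = 0"
      using True by (intro sum.neutral) (simp add: dmat_dmat)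
    finally show ?thesis .
  qed (simp add: bd_def)
qed

text \<open>Exactness of Mayer-Vietoris at its middle term, between Tor_i of the intersection and
  Tor_i of the union.\<close>

lemma van_Int_Un_left:
  assumes U: "upset X U" and V: "upset X V"
    and van_Int: "van C (U \<inter> V) i j" and van_Un: "van C (U \<union> V) i j"
  shows "van C U i j"
proof (rule vanI)
  fix z assume z: "z \<in> chains C (mcomp U) i j" and cyc: "\<And>i'. i = Suc i' \<Longrightarrow> bdR C i' z = (\<lambda>_. 0)"
  have "z \<in> chains C (mcomp (U \<union> V)) i j" using z chains_mono[of U "U \<union> V"] by blast
  then obtain w where w: "w \<in> chains C (mcomp (U \<union> V)) (Suc i) j" "z = bdR C i w"
    using vanD[OF van_Un _ cyc] by metis
  from w(1) obtain w1 w2 where w12: "w1 \<in> chains C (mcomp U) (Suc i) j"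
      "w2 \<in> chains C (mcomp V) (Suc i) j" "w = (\<lambda>b. w1 b + w2 b)"
    by (rule chains_Un_split)
  have eq: "z = (\<lambda>c. bdR C i w1 c + bdR C i w2 c)" using w(2) w12(3) by (simp add: bdR_add)
  \<comment> \<open>The boundary of the \<open>V\<close>-part lies in \<open>V\<close> and, being
    \<open>z\<close> minus a boundary over \<open>U\<close>, also in \<open>U\<close>. So it is a
    cycle over the intersection and can be bounded there.\<close>
  then have "bdR C i w2 = (\<lambda>c. z c - bdR C i w1 c)" by auto
  then have "bdR C i w2 \<in> chains C (mcomp U) i j"
    using chains_diff[OF z bd_chains[OF U w12(1)]] by simp
  then have "bdR C i w2 \<in> chains C (mcomp (U \<inter> V)) i j"
    using bd_chains[OF V w12(2)] by (rule chains_Int)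
  then obtain w3 where w3: "w3 \<in> chains C (mcomp (U \<inter> V)) (Suc i) j" "bdR C i w2 = bdR C i w3"
    using vanD[OF van_Int, of "bdR C i w2"] bd_bd by metis
  have "w3 \<in> chains C (mcomp U) (Suc i) j" using w3(1) chains_mono[of "U \<inter> V" U] by blast
  then have "(\<lambda>b. w1 b + w3 b) \<in> chains C (mcomp U) (Suc i) j" using w12(1) chains_add by blast
  moreover have "z = bdR C i (\<lambda>b. w1 b + w3 b)" using eq w3(2) by (simp add: bdR_add)
  ultimately show "\<exists>g\<in>chains C (mcomp U) (Suc i) j. z = bdR C i g" by blast
qed

text \<open>Exactness at Tor_i of the union, whose connecting map goes to Tor_(i-1) of the
  intersection. For \<open>i = 0\<close> there is no connecting term, hence the conditional
  hypothesis.\<close>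

lemma van_Un:
  assumes U: "upset X U" and V: "upset X V"
    and van: "van C U i j" "van C V i j" and van_Int: "\<And>i'. i = Suc i' \<Longrightarrow> van C (U \<inter> V) i' j"
  shows "van C (U \<union> V) i j"
proof (rule vanI)
  fix z assume z: "z \<in> chains C (mcomp (U \<union> V)) i j" and cyc: "\<And>i'. i = Suc i' \<Longrightarrow> bdR C i' z = (\<lambda>_. 0)"
  from z obtain z1 z2 where z12: "z1 \<in> chains C (mcomp U) i j"
      "z2 \<in> chains C (mcomp V) i j" "z = (\<lambda>b. z1 b + z2 b)"
    by (rule chains_Un_split)
  \<comment> \<open>The summands of a cycle need not be cycles, but their boundaries are opposite
    and so lie in the intersection. A \<open>w\<close> over the intersection with the boundary of
    \<open>z1\<close> makes both \<open>z1 - w\<close> and \<open>z2 + w\<close> cycles.\<close>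
  obtain w where w: "w \<in> chains C (mcomp (U \<inter> V)) i j"
    "\<And>i'. i = Suc i' \<Longrightarrow> bdR C i' w = bdR C i' z1"
  proof (cases i)
    case 0
    then show ?thesis using that[of "\<lambda>_. 0"] by simp
  next
    case (Suc i')
    have "(\<lambda>c. bdR C i' z1 c + bdR C i' z2 c) = (\<lambda>_. 0)" using cyc[OF Suc] z12(3) by (simp add: bdR_add)
    then have eq: "bdR C i' z1 = (\<lambda>c. - bdR C i' z2 c)"
      by (auto simp: fun_eq_iff add_eq_0_iff2)
    have "bdR C i' z1 \<in> chains C (mcomp (U \<inter> V)) i' j"
    proof (rule chains_Int)
      show "bdR C i' z1 \<in> chains C (mcomp U) i' j" using bd_chains[OF U] z12(1) Suc by blast
      show "bdR C i' z1 \<in> chains C (mcomp V) i' j"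
        using chains_uminus[OF bd_chains[OF V]] z12(2) Suc unfolding eq by blast
    qed
    then obtain w where "w \<in> chains C (mcomp (U \<inter> V)) (Suc i') j" "bdR C i' z1 = bdR C i' w"
      using vanD[OF van_Int[OF Suc], of "bdR C i' z1"] bd_bd by metis
    then show ?thesis using that[of w] Suc by simp
  qed
  have wU: "w \<in> chains C (mcomp U) i j" and wV: "w \<in> chains C (mcomp V) i j"
    using w(1) chains_mono[of "U \<inter> V" U] chains_mono[of "U \<inter> V" V] by blast+
  have "(\<lambda>b. z1 b - w b) \<in> chains C (mcomp U) i j" using z12(1) wU by (rule chains_diff)
  then obtain g1 where g1: "g1 \<in> chains C (mcomp U) (Suc i) j" "(\<lambda>b. z1 b - w b) = bdR C i g1"
    using w(2) vanD[OF van(1), of "\<lambda>b. z1 b - w b"] by (auto simp: bdR_diff)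
  have "(\<lambda>b. z2 b + w b) \<in> chains C (mcomp V) i j" using z12(2) wV by (rule chains_add)
  moreover have "bdR C i' (\<lambda>b. z2 b + w b) = (\<lambda>_. 0)" if "i = Suc i'" for i'
    using cyc[OF that] w(2)[OF that] by (simp add: bdR_add z12(3) add.commute)
  ultimately obtain g2 where g2: "g2 \<in> chains C (mcomp V) (Suc i) j" "(\<lambda>b. z2 b + w b) = bdR C i g2"
    using vanD[OF van(2), of "\<lambda>b. z2 b + w b"] by blast
  have "z = (\<lambda>b. (z1 b - w b) + (z2 b + w b))" by (simp add: z12(3))
  also have "\<dots> = bdR C i (\<lambda>b. g1 b + g2 b)"
    unfolding bdR_add g1(2)[symmetric] g2(2)[symmetric] by simp
  finally have "z = bdR C i (\<lambda>b. g1 b + g2 b)" .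
  moreover have "(\<lambda>b. g1 b + g2 b) \<in> chains C (mcomp (U \<union> V)) (Suc i) j"
    using g1(1) g2(1) chains_mono[of U "U \<union> V"] chains_mono[of V "U \<union> V"] by (intro chains_add) auto
  ultimately show "\<exists>g\<in>chains C (mcomp (U \<union> V)) (Suc i) j. z = bdR C i g" by blast
qed

lemma van_shift:
  assumes "van C U i (j - int (mdeg m))"
  shows "van C ((+) m ` U) i j"
proof (rule vanI)
  fix z assume z: "z \<in> chains C (mcomp ((+) m ` U)) i j" and cyc: "\<And>i'. i = Suc i' \<Longrightarrow> bdR C i' z = (\<lambda>_. 0)"
  from z obtain y where y: "y \<in> chains C (mcomp U) i (j - int (mdeg m))" "z = (\<lambda>b. mon m * y b)"
    by (rule chains_shift_ex)
  have "bdR C i' y = (\<lambda>_. 0)" if "i = Suc i'" for i'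
  proof
    fix c
    have "mon m * bdR C i' y c = mon m * 0" using cyc[OF that] y(2) by (simp add: bdR_mult fun_eq_iff)
    then show "bdR C i' y c = 0" by (rule mon_mult_cancel)
  qed
  then obtain g where g: "g \<in> chains C (mcomp U) (Suc i) (j - int (mdeg m))" "y = bdR C i g"
    using vanD[OF assms y(1)] by metis
  show "\<exists>g\<in>chains C (mcomp ((+) m ` U)) (Suc i) j. z = bdR C i g"
    using g y(2) by (intro bexI[of _ "\<lambda>b. mon m * g b"]) (auto simp: bdR_mult chains_shift_iff)
qed

text \<open>With coefficients in the ring itself the homology of the complex is the field, in
  bidegree (0, 0).\<close>

lemma van_monoms: "i \<noteq> 0 \<or> j \<noteq> 0 \<Longrightarrow> van C (monoms X) i j"
proof (cases i)
  case (Suc i')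
  then show ?thesis using res
    by (auto simp: graded_free_resolution_of_K_def R_comp_eq van_def)
next
  case 0
  assume "i \<noteq> 0 \<or> j \<noteq> 0"
  then have j: "j \<noteq> 0" using 0 by simp
  have r: "augmentation C ` chains C (mcomp (monoms X)) 0 j = K_comp j"
    "{f \<in> chains C (mcomp (monoms X)) 0 j. augmentation C f = 0} = boundaries C (*) (mcomp (monoms X)) 0 j"
    using res by (auto simp: graded_free_resolution_of_K_def R_comp_eq)
  \<comment> \<open>For \<open>j \<noteq> 0\<close> the component of the field is zero, so every
    chain lies in the kernel of the augmentation, which consists of boundaries.\<close>
  have "augmentation C f = 0" if "f \<in> chains C (mcomp (monoms X)) 0 j" for f
    using that r(1) j by (auto simp: K_comp_def)
  then show ?thesis unfolding van_def using r(2) 0 by (auto simp: cycles_def)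
qed

lemma not_van_monoms: "\<not> van C (monoms X) 0 0"
proof
  assume "van C (monoms X) 0 0"
  then have sub: "chains C (mcomp (monoms X)) 0 0 \<subseteq> boundaries C (*) (mcomp (monoms X)) 0 0"
    by (simp add: van_def cycles_def)
  have r: "augmentation C ` chains C (mcomp (monoms X)) 0 0 = UNIV"
    "{f \<in> chains C (mcomp (monoms X)) 0 0. augmentation C f = 0} = boundaries C (*) (mcomp (monoms X)) 0 0"
    using res by (auto simp: graded_free_resolution_of_K_def R_comp_eq K_comp_def)
  obtain f where f: "f \<in> chains C (mcomp (monoms X)) 0 0" "augmentation C f = 1"
    using r(1) by (metis UNIV_I imageE)
  have "f \<in> {f \<in> chains C (mcomp (monoms X)) 0 0. augmentation C f = 0}"
    unfolding r(2) using f(1) sub by blast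
  then show False using f(2) by simp
qed

lemma van_empty: "van C {} i j"
proof (rule vanI)
  fix f :: "nat \<Rightarrow> ('x, 'k) mpoly"
  assume "f \<in> chains C (mcomp {}) i j"
  then have "f b = 0" for b by (cases "b < rank C i") (auto simp: chains_def mcomp_def)
  then have "f = bdR C i (\<lambda>_. 0)" by auto
  then show "\<exists>g\<in>chains C (mcomp {}) (Suc i) j. f = bdR C i g" using chains_zero by blast
qed

end

subsection \<open>Squarefree monomial ideals\<close>

definition sqm :: "'x set \<Rightarrow> 'x \<Rightarrow>\<^sub>0 nat" where
  "sqm g = (\<Sum>a\<in>g. single a 1)"

lemma lookup_sqm: "finite g \<Longrightarrow> lookup (sqm g) a = (if a \<in> g then 1 else 0)"
  by (auto simp: sqm_def lookup_sum lookup_single when_def)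

lemma keys_sqm: "finite g \<Longrightarrow> keys (sqm g) = g"
  by (auto simp: in_keys_iff lookup_sqm split: if_splits)

lemma mdeg_sqm: "finite g \<Longrightarrow> mdeg (sqm g) = card g"
  by (simp add: mdeg_def keys_sqm lookup_sqm)

lemma range_sqm_iff: "finite g \<Longrightarrow> m \<in> range ((+) (sqm g)) \<longleftrightarrow> g \<subseteq> keys m"
proof
  assume g: "finite g" "g \<subseteq> keys m"
  then have "m = sqm g + (m - sqm g)"
    by (intro poly_mapping_eqI) (auto simp: lookup_add lookup_minus lookup_sqm in_keys_iff subset_iff Suc_le_eq)
  then show "m \<in> range ((+) (sqm g))" by blast
qed (auto simp: keys_add_nat keys_sqm)

text \<open>The monomials of the ideal generated by the squarefree monomials with supports in
  \<open>F\<close>; divisibility by such a generator depends on supports alone. A singleton in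
  \<open>F\<close> stands for a variable.\<close>

definition sq :: "'x set \<Rightarrow> 'x set set \<Rightarrow> ('x \<Rightarrow>\<^sub>0 nat) set" where
  "sq X F = {m \<in> monoms X. \<exists>e\<in>F. e \<subseteq> keys m}"

lemma upset_sq: "upset X (sq X F)"
  unfolding upset_def sq_def monoms_def by (auto simp: keys_add_nat)

lemma sq_insert: "sq X (insert g F) = sq X F \<union> sq X {g}"
  by (auto simp: sq_def)

lemma sq_empty [simp]: "sq X {} = {}"
  by (simp add: sq_def)

text \<open>A squarefree \<open>e\<close> divides the product of \<open>g\<close> and
  \<open>t\<close> iff \<open>e - g\<close> divides \<open>t\<close>. So the intersection with the
  principal ideal of \<open>g\<close> is \<open>g\<close> times the colon ideal, which the
  \<open>e - g\<close> generate.\<close>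

lemma sq_colon:
  assumes g: "finite g" "g \<subseteq> X"
  shows "sq X F \<inter> sq X {g} = (+) (sqm g) ` sq X ((\<lambda>e. e - g) ` F)"
proof (intro equalityI subsetI)
  fix m assume m: "m \<in> sq X F \<inter> sq X {g}"
  then obtain t where t: "m = sqm g + t" using range_sqm_iff[OF g(1), of m] by (auto simp: sq_def)
  have "t \<in> sq X ((\<lambda>e. e - g) ` F)"
    using m g by (auto simp: sq_def monoms_def t keys_add_nat keys_sqm)
  then show "m \<in> (+) (sqm g) ` sq X ((\<lambda>e. e - g) ` F)" using t by blast
next
  fix m assume "m \<in> (+) (sqm g) ` sq X ((\<lambda>e. e - g) ` F)"
  then show "m \<in> sq X F \<inter> sq X {g}"
    using g by (fastforce simp: sq_def monoms_def keys_add_nat keys_sqm Diff_subset_conv)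
qed

lemma sq_colon_disjoint:
  assumes "finite g" "g \<subseteq> X" "\<And>e. e \<in> F \<Longrightarrow> e \<inter> g = {}"
  shows "sq X F \<inter> sq X {g} = (+) (sqm g) ` sq X F"
proof -
  have "(\<lambda>e. e - g) ` F = (\<lambda>e. e) ` F"
    using assms(3) by (intro image_cong refl) (simp add: Diff_triv)
  then show ?thesis using sq_colon[OF assms(1,2), of F] by simp
qed

lemma sq_single:
  assumes "finite g" "g \<subseteq> X"
  shows "sq X {g} = (+) (sqm g) ` monoms X"
proof -
  have "sq X {{}} = monoms X" by (auto simp: sq_def)
  then show ?thesis using sq_colon[OF assms, of "{g}"] by simp
qed

text \<open>The lower bound 1 keeps the set of the values \<open>j - i\<close> finite, as its maximum requires.\<close>

definition reg_le :: "('x, 'k::field) free_complex \<Rightarrow> ('x \<Rightarrow>\<^sub>0 nat) set \<Rightarrow> int \<Rightarrow> bool" where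
  "reg_le C U r \<longleftrightarrow> (\<forall>i j. \<not> (1 \<le> j - int i \<and> j - int i \<le> r) \<longrightarrow> van C U i j)"

lemma reg_leD: "reg_le C U r \<Longrightarrow> j - int i < 1 \<or> r < j - int i \<Longrightarrow> van C U i j"
  by (force simp: reg_le_def)

lemma reg_leI: "(\<And>i j. j - int i < 1 \<or> r < j - int i \<Longrightarrow> van C U i j) \<Longrightarrow> reg_le C U r"
  by (force simp: reg_le_def)

context resolution
begin

lemma van_sq_single:
  assumes "finite g" "g \<subseteq> X" "i \<noteq> 0 \<or> j \<noteq> int (card g)"
  shows "van C (sq X {g}) i j"
proof -
  have "van C (monoms X) i (j - int (mdeg (sqm g)))"
    using assms by (intro van_monoms) (simp add: mdeg_sqm)
  then show ?thesis using assms by (simp add: sq_single van_shift)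
qed

text \<open>As supports are disjoint, the ideals of \<open>F\<close> and \<open>g\<close> intersect
  in a copy of the former shifted by \<open>card g\<close>. The connecting map lowers
  \<open>i\<close> by 1, whence the increase by \<open>card g - 1\<close>, which is zero for a
  variable.\<close>

lemma reg_le_insert_disjoint:
  assumes "reg_le C (sq X F) r" "1 \<le> r" "finite g" "g \<subseteq> X" "g \<noteq> {}"
    and disj: "\<And>e. e \<in> F \<Longrightarrow> e \<inter> g = {}"
  shows "reg_le C (sq X (insert g F)) (r + int (card g) - 1)"
  unfolding sq_insert[of X g F]
proof (intro reg_leI van_Un upset_sq)
  fix i j assume ij: "j - int i < 1 \<or> r + int (card g) - 1 < j - int i"
  have g: "int (card g) \<ge> 1" using assms(3,5) by (simp add: Suc_le_eq card_gt_0_iff)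
  show "van C (sq X F) i j" by (rule reg_leD[OF assms(1)]) (use ij g in linarith)
  show "van C (sq X {g}) i j" by (rule van_sq_single[OF assms(3,4)]) (use ij g assms(2) in linarith)
  show "van C (sq X F \<inter> sq X {g}) i' j" if "i = Suc i'" for i'
  proof -
    have "van C (sq X F) i' (j - int (mdeg (sqm g)))"
      by (rule reg_leD[OF assms(1)]) (use ij g that mdeg_sqm[OF assms(3)] in linarith)
    then show ?thesis by (simp add: sq_colon_disjoint[OF assms(3,4) disj] van_shift)
  qed
qed

lemma reg_le_add_vars:
  assumes "reg_le C (sq X F) r" "1 \<le> r" "finite A" "A \<subseteq> X" "\<And>e. e \<in> F \<Longrightarrow> e \<inter> A = {}"
  shows "reg_le C (sq X (F \<union> (\<lambda>a. {a}) ` A)) r"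
  using assms(3,4,5)
proof (induction A rule: finite_induct)
  case empty
  then show ?case using assms(1) by simp
next
  case (insert a A)
  have "reg_le C (sq X (insert {a} (F \<union> (\<lambda>a. {a}) ` A))) (r + int (card {a}) - 1)"
    using insert assms(2) by (intro reg_le_insert_disjoint) auto
  then show ?case by simp
qed

text \<open>The intersection with the ideal of \<open>v\<close> is \<open>v\<close> times the colon
  ideal, so the bound \<open>r\<close> for the colon ideal becomes \<open>r + 1\<close> for the
  intersection.\<close>

lemma reg_le_delete:
  assumes "v \<in> X" "reg_le C (sq X ((\<lambda>e. e - {v}) ` F)) r" "reg_le C (sq X (insert {v} F)) (r + 1)"
  shows "reg_le C (sq X F) (r + 1)"
proof (rule reg_leI)
  fix i j assume ij: "j - int i < 1 \<or> r + 1 < j - int i"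
  have "van C (sq X ((\<lambda>e. e - {v}) ` F)) i (j - int (mdeg (sqm {v})))"
    by (rule reg_leD[OF assms(2)]) (use ij mdeg_sqm[of "{v}"] in auto)
  then have "van C (sq X F \<inter> sq X {{v}}) i j"
    using assms(1) by (simp add: sq_colon van_shift)
  moreover have "van C (sq X F \<union> sq X {{v}}) i j"
    unfolding sq_insert[symmetric] by (rule reg_leD[OF assms(3) ij])
  ultimately show "van C (sq X F) i j" by (rule van_Int_Un_left[OF upset_sq upset_sq])
qed

end

section \<open>Vertex elimination and the upper bound\<close>

definition edges_in :: "'x set set \<Rightarrow> 'x set \<Rightarrow> 'x set set" where
  "edges_in E W = {e \<in> E. e \<subseteq> W}"

definition nbrs :: "'x set set \<Rightarrow> 'x set \<Rightarrow> 'x \<Rightarrow> 'x set" where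
  "nbrs E W v = {w \<in> W. {v, w} \<in> E}"

text \<open>A record of eliminations: \<open>v\<close> is a vertex whose closed neighbourhood is
  removed, \<open>w\<close> a neighbour witnessing that it was not isolated. The abstract
  \<open>lev\<close> becomes the level \<open>snd\<close> on the vertices of
  \<open>Gk_edges\<close>.\<close>

definition oseq :: "'x set set \<Rightarrow> ('x \<Rightarrow> nat) \<Rightarrow> 'x set \<Rightarrow> ('x \<times> 'x) list \<Rightarrow> bool" where
  "oseq E lev W ps \<longleftrightarrow>
     (\<forall>(v, w)\<in>set ps. v \<in> W \<and> w \<in> W \<and> {v, w} \<in> E \<and> lev v \<le> lev w) \<and>
     sorted_wrt (\<lambda>(v, w) (v', w'). lev v \<le> lev v' \<and> {v, v'} \<notin> E \<and> {v, w'} \<notin> E) ps"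

lemma oseq_mono: "oseq E lev W ps \<Longrightarrow> W \<subseteq> W' \<Longrightarrow> oseq E lev W' ps"
  by (auto simp: oseq_def)

text \<open>Dividing an edge at \<open>v\<close> by \<open>v\<close> leaves the variable of its
  other end. These variables divide every edge meeting the neighbourhood, so only the edges away
  from it survive as generators.\<close>

lemma sq_edges_colon:
  assumes E: "\<And>e. e \<in> E \<Longrightarrow> card e = 2" and v: "v \<in> W"
  shows "sq X ((\<lambda>e. e - {v}) ` edges_in E W)
    = sq X (edges_in E (W - {v} - nbrs E W v) \<union> (\<lambda>a. {a}) ` nbrs E W v)"
proof (intro equalityI subsetI)
  fix m assume "m \<in> sq X ((\<lambda>e. e - {v}) ` edges_in E W)"
  then obtain e where e: "m \<in> monoms X" "e \<in> E" "e \<subseteq> W" "e - {v} \<subseteq> keys m"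
    by (auto simp: sq_def edges_in_def)
  show "m \<in> sq X (edges_in E (W - {v} - nbrs E W v) \<union> (\<lambda>a. {a}) ` nbrs E W v)"
  proof (cases "v \<in> e")
    case True
    obtain w where "e = {v, w}" "w \<noteq> v"
      using E[OF e(2)] True by (auto simp: card_2_iff)
    then have "w \<in> nbrs E W v" "w \<in> keys m" using e by (auto simp: nbrs_def)
    then show ?thesis using e(1) by (auto simp: sq_def)
  next
    case False
    then have ek: "e \<subseteq> keys m" "e \<subseteq> W - {v}" using e(3,4) by auto
    show ?thesis
    proof (cases "e \<inter> nbrs E W v = {}")
      case True
      then have "e \<in> edges_in E (W - {v} - nbrs E W v)"
        using ek(2) e(2) by (auto simp: edges_in_def)
      then show ?thesis using e(1) ek(1) unfolding sq_def by blast
    next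
      case False
      then obtain a where "a \<in> nbrs E W v" "{a} \<subseteq> keys m" using ek(1) by blast
      then show ?thesis using e(1) unfolding sq_def by blast
    qed
  qed
next
  fix m assume m: "m \<in> sq X (edges_in E (W - {v} - nbrs E W v) \<union> (\<lambda>a. {a}) ` nbrs E W v)"
  then have mX: "m \<in> monoms X" by (simp add: sq_def)
  from m consider (a) a where "a \<in> nbrs E W v" "a \<in> keys m"
    | (e) e where "e \<in> edges_in E (W - {v} - nbrs E W v)" "e \<subseteq> keys m"
    by (auto simp: sq_def)
  then show "m \<in> sq X ((\<lambda>e. e - {v}) ` edges_in E W)"
  proof cases
    case a
    then have "{v, a} \<in> edges_in E W" "{v, a} - {v} \<subseteq> keys m"
      using v by (auto simp: nbrs_def edges_in_def)
    then show ?thesis using mX unfolding sq_def by blast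
  next
    case e
    then have "e \<in> edges_in E W" "e - {v} \<subseteq> keys m"
      by (auto simp: edges_in_def)
    then show ?thesis using mX unfolding sq_def by blast
  qed
qed

lemma sq_insert_vertex:
  "sq X (insert {v} (edges_in E W)) = sq X (insert {v} (edges_in E (W - {v})))"
proof -
  have "e \<in> edges_in E W \<longleftrightarrow> e \<in> edges_in E (W - {v})" if "v \<notin> e" for e
    using that by (auto simp: edges_in_def)
  then have "(\<exists>e\<in>insert {v} (edges_in E W). e \<subseteq> keys m)
    \<longleftrightarrow> (\<exists>e\<in>insert {v} (edges_in E (W - {v})). e \<subseteq> keys m)" for m :: "'a \<Rightarrow>\<^sub>0 nat"
    by (cases "v \<in> keys m") (simp, blast)
  then show ?thesis by (simp only: sq_def)
qed

context resolution
begin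

text \<open>Induction on the surviving vertices, while the ring stays over \<open>X\<close> so that
  one resolution serves throughout. Of the two branches only the removal of the closed neighbourhood
  raises the bound, and there each sequence extends by one pair.\<close>

lemma reg_le_edges:
  fixes lev :: "'x \<Rightarrow> nat"
  assumes "finite W" "W \<subseteq> X" and E: "\<And>e. e \<in> E \<Longrightarrow> card e = 2"
    and "\<And>ps. oseq E lev W ps \<Longrightarrow> length ps \<le> r"
  shows "reg_le C (sq X (edges_in E W)) (int r + 1)"
  using assms(1,2,4)
proof (induction "card W" arbitrary: W r rule: less_induct)
  case less
  define S where "S = {v \<in> W. \<exists>w\<in>W. {v, w} \<in> E}"
  show ?case
  proof (cases "S = {}")
    case True
    have "edges_in E W = {}"
    proof (rule ccontr)
      assume "edges_in E W \<noteq> {}"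
      then obtain e where e: "e \<in> E" "e \<subseteq> W" by (auto simp: edges_in_def)
      then obtain u w where "e = {u, w}" using E[OF e(1)] by (auto simp: card_2_iff)
      then have "u \<in> S" using e by (auto simp: S_def)
      then show False using True by simp
    qed
    then show ?thesis by (simp add: reg_le_def van_empty)
  next
    case False
    \<comment> \<open>Recorded vertices are never isolated, so minimality of the level within
      \<open>S\<close> suffices for all later pairs.\<close>
    then obtain v where v: "v \<in> S" "\<And>u. u \<in> S \<Longrightarrow> lev v \<le> lev u"
      using ex_has_least_nat[of "\<lambda>u. u \<in> S" _ lev] by blast
    from v(1) obtain w where w: "w \<in> W" "{v, w} \<in> E" and vW: "v \<in> W" by (auto simp: S_def)
    have wS: "w \<in> S" using w vW by (auto simp: S_def insert_commute)
    define N where "N = nbrs E W v"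
    have N: "N \<subseteq> W" "finite N" using less.prems(1) by (auto simp: N_def nbrs_def)
    have len: "length ps + 1 \<le> r" if ps: "oseq E lev (W - {v} - N) ps" for ps
    proof -
      have "oseq E lev W ((v, w) # ps)"
      proof -
        have "lev v \<le> lev v' \<and> {v, v'} \<notin> E \<and> {v, w'} \<notin> E" if "(v', w') \<in> set ps" for v' w'
        proof -
          have vw': "v' \<in> W" "w' \<in> W" "v' \<notin> N" "w' \<notin> N" "{v', w'} \<in> E"
            using ps that by (auto simp: oseq_def)
          then have "v' \<in> S" by (auto simp: S_def)
          then show ?thesis using vw' v(2) by (auto simp: N_def nbrs_def)
        qed
        then show ?thesis using ps w vW v(2)[OF wS] by (auto simp: oseq_def)
      qed
      then show ?thesis using less.prems(3)[of "(v, w) # ps"] by simp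
    qed
    \<comment> \<open>The empty sequence shows that \<open>r\<close> is positive, so that
      \<open>r - 1\<close> in \<open>IH2\<close> is a genuine predecessor.\<close>
    have r: "1 \<le> r" using len[of "[]"] by (simp add: oseq_def)
    have "card (W - {v}) < card W" "card (W - {v} - N) < card W"
      by (intro psubset_card_mono less.prems(1); use vW in blast)+
    then have IH1: "reg_le C (sq X (edges_in E (W - {v}))) (int r + 1)"
      and IH2: "reg_le C (sq X (edges_in E (W - {v} - N))) (int (r - 1) + 1)"
      using less.prems len r
      by (intro less.hyps; fastforce dest: oseq_mono[of _ _ _ _ W])+
    have colon: "sq X ((\<lambda>e. e - {v}) ` edges_in E W) = sq X (edges_in E (W - {v} - N) \<union> (\<lambda>a. {a}) ` N)"
      unfolding N_def by (rule sq_edges_colon) (fact E, fact vW)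
    have "reg_le C (sq X ((\<lambda>e. e - {v}) ` edges_in E W)) (int r)"
      unfolding colon using IH2 r N less.prems(2) by (intro reg_le_add_vars) (auto simp: edges_in_def)
    moreover have "reg_le C (sq X (insert {v} (edges_in E W))) (int r + 1)"
    proof -
      have "reg_le C (sq X (edges_in E (W - {v}) \<union> (\<lambda>a. {a}) ` {v})) (int r + 1)"
        using IH1 r vW less.prems(2) by (intro reg_le_add_vars) (auto simp: edges_in_def)
      then show ?thesis by (simp add: sq_insert_vertex[of X v E W])
    qed
    moreover have "v \<in> X" using vW less.prems(2) by blast
    ultimately show ?thesis by (metis reg_le_delete)
  qed
qed

section \<open>Nonvanishing of Tor for disjoint edges\<close>

lemma van_shift_iff: "van C ((+) m ` U) i j \<longleftrightarrow> van C U i (j - int (mdeg m))"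
proof
  assume van: "van C ((+) m ` U) i j"
  show "van C U i (j - int (mdeg m))"
  proof (rule vanI)
    fix y assume y: "y \<in> chains C (mcomp U) i (j - int (mdeg m))"
      and cyc: "\<And>i'. i = Suc i' \<Longrightarrow> bdR C i' y = (\<lambda>_. 0)"
    have "(\<lambda>b. mon m * y b) \<in> chains C (mcomp ((+) m ` U)) i j"
      using y by (simp add: chains_shift_iff)
    moreover have "bdR C i' (\<lambda>b. mon m * y b) = (\<lambda>_. 0)" if "i = Suc i'" for i'
      using cyc[OF that] by (simp add: bdR_mult)
    ultimately obtain z where z: "z \<in> chains C (mcomp ((+) m ` U)) (Suc i) j" "(\<lambda>b. mon m * y b) = bdR C i z"
      using vanD[OF van] by blast
    from z(1) obtain g where g: "g \<in> chains C (mcomp U) (Suc i) (j - int (mdeg m))" "z = (\<lambda>b. mon m * g b)"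
      by (rule chains_shift_ex)
    have "y = bdR C i g"
      by (rule ext, rule mon_mult_cancel[of m]) (use z(2) g(2) in \<open>simp add: bdR_mult fun_eq_iff\<close>)
    then show "\<exists>g\<in>chains C (mcomp U) (Suc i) (j - int (mdeg m)). y = bdR C i g" using g(1) by blast
  qed
qed (rule van_shift)

text \<open>The connecting map from Tor_r of the larger ideal to Tor_(r-1) of the intersection, a
  copy of \<open>sq X F\<close> shifted by 2, is onto in degree 2r + 2: there Tor_(r-1) of
  \<open>sq X F\<close> vanishes by the regularity bound, and that of the ideal of \<open>e\<close>
  because it is free on a generator of degree 2. So the nonzero class in degree 2r is hit.\<close>

lemma not_van_insert_disjoint_edge:
  assumes M: "reg_le C (sq X F) (int r + 1)" "\<not> van C (sq X F) (r - 1) (2 * int r)" "1 \<le> r"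
    and e: "card e = 2" "e \<subseteq> X" and disj: "\<And>f. f \<in> F \<Longrightarrow> f \<inter> e = {}"
  shows "\<not> van C (sq X (insert e F)) r (2 * int r + 2)"
proof
  assume van: "van C (sq X (insert e F)) r (2 * int r + 2)"
  have fe: "finite e" using e(1) card_ge_0_finite[of e] by simp
  define U m where "U = sq X F" and "m = sqm e"
  have U: "upset X U" by (simp add: U_def upset_sq)
  have m: "int (mdeg m) = 2" using e fe by (simp add: m_def mdeg_sqm)
  have sqe: "sq X {e} = (+) m ` monoms X" using sq_single[OF fe e(2)] by (simp add: m_def)
  have Int: "U \<inter> sq X {e} = (+) m ` U" using sq_colon_disjoint[OF fe e(2) disj] by (simp add: U_def m_def)
  have UX: "U \<subseteq> monoms X" using U by (simp add: upset_def)
  obtain r' where r': "r = Suc r'" using M(3) by (cases r) auto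
  have "van C U r' (2 * int r)"
  proof (rule vanI)
    fix y assume y: "y \<in> chains C (mcomp U) r' (2 * int r)"
      and cyc: "\<And>i'. r' = Suc i' \<Longrightarrow> bdR C i' y = (\<lambda>_. 0)"
    have my: "(\<lambda>b. mon m * y b) \<in> chains C (mcomp ((+) m ` U)) r' (2 * int r + 2)"
      using y m by (simp add: chains_shift_iff)
    then have "(\<lambda>b. mon m * y b) \<in> chains C (mcomp U) r' (2 * int r + 2)"
      using Int chains_mono[of "(+) m ` U" U] by blast
    moreover have "bdR C i' (\<lambda>b. mon m * y b) = (\<lambda>_. 0)" if "r' = Suc i'" for i'
      using cyc[OF that] by (simp add: bdR_mult)
    moreover have "van C U r' (2 * int r + 2)"
      unfolding U_def by (rule reg_leD[OF M(1)]) (use r' in simp)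
    ultimately obtain w1 where w1: "w1 \<in> chains C (mcomp U) r (2 * int r + 2)"
        "(\<lambda>b. mon m * y b) = bdR C r' w1"
      using vanD r' by metis
    have "y \<in> chains C (mcomp (monoms X)) r' (2 * int r)" using y UX chains_mono by blast
    moreover have "van C (monoms X) r' (2 * int r)" using M(3) by (intro van_monoms) simp
    ultimately obtain w2 where w2: "w2 \<in> chains C (mcomp (monoms X)) r (2 * int r)" "y = bdR C r' w2"
      using cyc vanD r' by metis
    \<comment> \<open>\<open>mon m * y\<close> is bounded over \<open>U\<close> by \<open>w1\<close>
      and over the ideal of \<open>e\<close> by \<open>mon m * w2\<close>. The difference is a cycle
      over the sum, which the connecting map sends to the class of \<open>y\<close>, up to
      sign.\<close>
    define z where "z = (\<lambda>b. w1 b - mon m * w2 b)"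
    have "z \<in> chains C (mcomp (U \<union> sq X {e})) r (2 * int r + 2)"
      unfolding z_def
    proof (rule chains_diff)
      show "w1 \<in> chains C (mcomp (U \<union> sq X {e})) r (2 * int r + 2)"
        using w1(1) by (rule chains_mono[rotated]) simp
      have "(\<lambda>b. mon m * w2 b) \<in> chains C (mcomp (sq X {e})) r (2 * int r + 2)"
        using w2(1) m by (simp add: sqe chains_shift_iff)
      then show "(\<lambda>b. mon m * w2 b) \<in> chains C (mcomp (U \<union> sq X {e})) r (2 * int r + 2)"
        by (rule chains_mono[rotated]) simp
    qed
    moreover have "bdR C r' z = (\<lambda>_. 0)"
      using w1(2) w2(2) by (simp add: z_def bdR_diff bdR_mult fun_eq_iff)
    ultimately obtain u where u: "u \<in> chains C (mcomp (U \<union> sq X {e})) (Suc r) (2 * int r + 2)" "z = bdR C r u"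
      using vanD[OF van, of z] r' by (metis U_def sq_insert nat.inject)
    from u(1) obtain u1 u2 where u12: "u1 \<in> chains C (mcomp U) (Suc r) (2 * int r + 2)"
        "u2 \<in> chains C (mcomp (sq X {e})) (Suc r) (2 * int r + 2)" "u = (\<lambda>b. u1 b + u2 b)"
      by (rule chains_Un_split)
    from u12(2) obtain t where t: "t \<in> chains C (mcomp (monoms X)) (Suc r) (2 * int r)" "u2 = (\<lambda>b. mon m * t b)"
      unfolding sqe by (rule chains_shift_ex) (use m in simp)
    \<comment> \<open>As \<open>z\<close> is a boundary, correcting \<open>w2\<close> by the
      boundary of \<open>t\<close> brings \<open>mon m * g\<close> into \<open>U\<close> as well as
      into the ideal of \<open>e\<close>. Hence \<open>g\<close> lies in \<open>U\<close>, and its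
      boundary is still \<open>y\<close>.\<close>
    define g where "g = (\<lambda>b. w2 b + bdR C r t b)"
    have "(\<lambda>b. mon m * g b) = (\<lambda>b. w1 b - bdR C r u1 b)"
    proof
      fix b
      have "w1 b - mon m * w2 b = bdR C r u1 b + mon m * bdR C r t b"
        using u(2) unfolding z_def u12(3) t(2) bdR_add bdR_mult by (rule fun_cong)
      then show "mon m * g b = w1 b - bdR C r u1 b"
        by (simp add: g_def algebra_simps)
    qed
    moreover have "(\<lambda>b. w1 b - bdR C r u1 b) \<in> chains C (mcomp U) r (2 * int r + 2)"
      using w1(1) bd_chains[OF U u12(1)] by (rule chains_diff)
    moreover have "g \<in> chains C (mcomp (monoms X)) r (2 * int r)"
      unfolding g_def using w2(1) bd_chains[OF upset_monoms t(1)] by (rule chains_add)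
    then have "(\<lambda>b. mon m * g b) \<in> chains C (mcomp (sq X {e})) r (2 * int r + 2)"
      using m by (simp add: sqe chains_shift_iff)
    ultimately have "(\<lambda>b. mon m * g b) \<in> chains C (mcomp ((+) m ` U)) r (2 * int r + 2)"
      unfolding Int[symmetric] by (intro chains_Int) simp_all
    then have "g \<in> chains C (mcomp U) (Suc r') (2 * int r)"
      using m r' by (simp add: chains_shift_iff)
    moreover have "y = bdR C r' g"
      unfolding g_def bdR_add using w2(2) bd_bd[of r' t] r' by simp
    ultimately show "\<exists>g\<in>chains C (mcomp U) (Suc r') (2 * int r). y = bdR C r' g" by blast
  qed
  then show False using M(2) r' by (simp add: U_def)
qed

text \<open>Both claims are proved in one induction, because the nonvanishing for one more edge uses
  the bound for the previous edges.\<close>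

lemma reg_le_disjoint_edges:
  assumes "finite M" "\<And>e. e \<in> M \<Longrightarrow> e \<subseteq> X \<and> card e = 2"
    and "\<And>e f. e \<in> M \<Longrightarrow> f \<in> M \<Longrightarrow> e \<noteq> f \<Longrightarrow> e \<inter> f = {}"
  shows "reg_le C (sq X M) (int (card M) + 1) \<and>
    (M \<noteq> {} \<longrightarrow> \<not> van C (sq X M) (card M - 1) (2 * int (card M)))"
  using assms
proof (induction M rule: finite_induct)
  case empty
  then show ?case by (simp add: reg_le_def van_empty)
next
  case (insert e M)
  have e: "e \<subseteq> X" "card e = 2" using insert.prems(1) by auto
  have fe: "finite e" "e \<noteq> {}" using e(2) card_ge_0_finite[of e] by auto
  have disj: "f \<inter> e = {}" if "f \<in> M" for f
    using insert.prems(2)[of f e] insert.hyps that by blast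
  have IH: "reg_le C (sq X M) (int (card M) + 1)"
    "M \<noteq> {} \<Longrightarrow> \<not> van C (sq X M) (card M - 1) (2 * int (card M))"
    using insert by auto
  have "reg_le C (sq X (insert e M)) (int (card M) + 1 + int (card e) - 1)"
    using IH(1) fe e disj by (intro reg_le_insert_disjoint) auto
  then have "reg_le C (sq X (insert e M)) (int (card (insert e M)) + 1)"
    using insert.hyps e(2) by (simp add: add.commute)
  \<comment> \<open>As \<open>e\<close> is new, the homological degree
    \<open>card (insert e M) - 1\<close> equals \<open>card M\<close>. For a single edge the ideal
    is the ring shifted by 2, with Tor_0 in degree 2.\<close>
  moreover have "\<not> van C (sq X (insert e M)) (card M) (2 * int (card M) + 2)"
  proof (cases "M = {}")
    case True
    then show ?thesis
      using not_van_monoms e fe by (simp add: sq_single van_shift_iff mdeg_sqm)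
  next
    case False
    then show ?thesis
      using IH e disj insert.hyps(1)
      by (intro not_van_insert_disjoint_edge) (auto simp: Suc_le_eq card_gt_0_iff)
  qed
  ultimately show ?case using insert.hyps by (simp add: algebra_simps)
qed

end

subsection \<open>Adjoining a variable\<close>

lemma sum_lessThan_add:
  "(\<Sum>b<m + n. f b) = (\<Sum>b<m. f b) + (\<Sum>b<n. f (m + b :: nat) :: 'a::comm_monoid_add)"
  by (induction n) (auto simp: add.assoc)

text \<open>The mapping cone of multiplication by \<open>x\<close>: in degree \<open>i\<close>, the basis elements of \<open>C\<close> in degree
  \<open>i\<close> come first, then those in degree \<open>i - 1\<close>.\<close>

definition cone :: "'x \<Rightarrow> ('x, 'k::field) free_complex \<Rightarrow> ('x, 'k) free_complex" where
  "cone x C = \<lparr>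
     rank = (\<lambda>i. rank C i + (case i of 0 \<Rightarrow> 0 | Suc i' \<Rightarrow> rank C i')),
     shift = (\<lambda>i b. if b < rank C i then shift C i b else shift C (i - 1) (b - rank C i) + 1),
     dmat = (\<lambda>i b c.
       if b < rank C (Suc i) then (if c < rank C i then dmat C i b c else 0)
       else if c < rank C i then (if c = b - rank C (Suc i) then var x else 0)
       else - dmat C (i - 1) (b - rank C (Suc i)) (c - rank C i)),
     aug = aug C\<rparr>"

lemma rank_cone: "rank (cone x C) 0 = rank C 0" "rank (cone x C) (Suc i) = rank C (Suc i) + rank C i"
  by (simp_all add: cone_def)

text \<open>In block form: (f1, f2) goes to (d f1 + x f2, - d f2). For \<open>i = 0\<close> the
  second block is empty, so the truncated \<open>i - 1\<close> does no harm.\<close>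

lemma bd_cone:
  "bdR (cone x C) i f c =
    (if c < rank C i then bdR C i f c + var x * f (rank C (Suc i) + c)
     else if c < rank (cone x C) i then - bdR C (i - 1) (\<lambda>b. f (rank C (Suc i) + b)) (c - rank C i)
     else 0)"
proof (cases "c < rank (cone x C) i")
  case False
  then have "\<not> c < rank C i" by (cases i) (auto simp: rank_cone)
  then show ?thesis using False by (simp add: bd_def)
next
  case True
  have split: "bdR (cone x C) i f c = (\<Sum>b<rank C (Suc i). dmat (cone x C) i b c * f b)
      + (\<Sum>b<rank C i. dmat (cone x C) i (rank C (Suc i) + b) c * f (rank C (Suc i) + b))"
    using True by (simp add: bd_def rank_cone sum_lessThan_add)
  show ?thesis
  proof (cases "c < rank C i")
    case c: True
    have "(\<Sum>b<rank C i. dmat (cone x C) i (rank C (Suc i) + b) c * f (rank C (Suc i) + b))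
        = (\<Sum>b<rank C i. if c = b then var x * f (rank C (Suc i) + b) else 0)"
      using c by (intro sum.cong refl) (auto simp: cone_def)
    also have "\<dots> = var x * f (rank C (Suc i) + c)" using c by simp
    finally show ?thesis using c unfolding split by (simp add: bd_def cone_def)
  next
    case c: False
    then obtain i' where i': "i = Suc i'" using True by (cases i) (auto simp: rank_cone)
    have "c - rank C i < rank C i'" using True c by (auto simp: i' rank_cone)
    then show ?thesis using c True unfolding split
      by (simp add: bd_def cone_def i' sum_negf)
  qed
qed

lemma bdR_cong: "(\<And>b. b < rank C (Suc i) \<Longrightarrow> f b = g b) \<Longrightarrow> bdR C i f = bdR C i g"
  by (auto simp: bd_def fun_eq_iff intro!: sum.cong)

text \<open>Every polynomial is uniquely \<open>at0 x p + x * qx x p\<close>, where \<open>x\<close> does not occur in \<open>at0 x p\<close>.\<close>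

definition at0 :: "'x \<Rightarrow> ('x, 'k::field) mpoly \<Rightarrow> ('x, 'k) mpoly" where
  "at0 x p = prestr {m. x \<notin> keys m} p"

definition qx :: "'x \<Rightarrow> ('x, 'k::field) mpoly \<Rightarrow> ('x, 'k) mpoly" where
  "qx x p = mdiv (single x 1) p"

lemma in_range_single_iff: "m \<in> range ((+) (single x (1::nat))) \<longleftrightarrow> x \<in> keys m"
  using range_sqm_iff[of "{x}" m] by (simp add: sqm_def)

lemma at0_qx: "at0 x p + var x * qx x p = p"
proof (rule poly_mapping_eqI)
  fix t
  show "lookup (at0 x p + var x * qx x p) t = lookup p t"
  proof (cases "x \<in> keys t")
    case True
    then obtain s where "t = single x 1 + s" using in_range_single_iff[of t x] by auto
    then show ?thesis using True
      by (simp add: lookup_add at0_def lookup_prestr var_def lookup_mon_mult qx_def lookup_mdiv)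
  next
    case False
    then have "t \<notin> keys (var x * qx x p)"
      using in_range_single_iff[of t x] by (auto simp: var_def keys_mon_mult)
    then have "lookup (var x * qx x p) t = 0" by (simp add: in_keys_iff)
    then show ?thesis using False by (simp add: lookup_add at0_def lookup_prestr)
  qed
qed

lemma at0_free: "keys p \<subseteq> {m. x \<notin> keys m} \<Longrightarrow> at0 x p = p"
  by (simp add: at0_def prestr_ident)

lemma at0_add: "at0 x (p + q) = at0 x p + at0 x q"
  by (simp add: at0_def prestr_add)

lemma at0_zero [simp]: "at0 x 0 = 0"
  by (simp add: at0_def)

lemma at0_var_mult: "at0 x (var x * q) = 0"
proof -
  have "keys (at0 x (var x * q)) = {}"
    by (auto simp: at0_def keys_prestr var_def keys_mon_mult keys_add_nat)
  then show ?thesis by simp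
qed

lemma qx_add: "qx x (p + q) = qx x p + qx x q"
  by (simp add: qx_def mdiv_add)

lemma qx_zero [simp]: "qx x 0 = 0"
  by (simp add: qx_def)

lemma qx_var_mult: "qx x (var x * q) = q"
  by (simp add: qx_def var_def mdiv_mon_mult)

lemma qx_free: "keys p \<subseteq> {m. x \<notin> keys m} \<Longrightarrow> qx x p = 0"
proof (rule poly_mapping_eqI)
  fix t :: "'a \<Rightarrow>\<^sub>0 nat" assume p: "keys p \<subseteq> {m. x \<notin> keys m}"
  have "x \<in> keys (single x (1::nat) + t)" by (simp add: keys_add_nat)
  then have "single x 1 + t \<notin> keys p" using p by blast
  then show "lookup (qx x p) t = lookup 0 t" by (simp add: qx_def lookup_mdiv in_keys_iff)
qed

text \<open>Multiplication by a factor free of \<open>x\<close> respects the decomposition of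
  \<open>p\<close>, so uniqueness makes both maps linear over such factors.\<close>

lemma
  assumes d: "keys d \<subseteq> {m. x \<notin> keys m}"
  shows at0_mult: "at0 x (d * p) = d * at0 x p" and qx_mult: "qx x (d * p) = d * qx x p"
proof -
  have eq: "d * p = d * at0 x p + var x * (d * qx x p)"
    by (subst at0_qx[of x p, symmetric]) (simp add: algebra_simps)
  have free: "keys (d * at0 x p) \<subseteq> {m. x \<notin> keys m}"
  proof
    fix m assume "m \<in> keys (d * at0 x p)"
    then obtain a b where "m = a + b" "a \<in> keys d" "b \<in> keys (at0 x p)"
      using keys_mult[of d "at0 x p"] by blast
    then show "m \<in> {m. x \<notin> keys m}" using d by (auto simp: keys_add_nat at0_def keys_prestr)
  qed
  show "at0 x (d * p) = d * at0 x p" "qx x (d * p) = d * qx x p"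
    unfolding eq at0_add qx_add at0_var_mult qx_var_mult
    using free by (simp_all add: at0_free qx_free)
qed

lemma at0_sum: "at0 x (sum f B) = (\<Sum>b\<in>B. at0 x (f b))"
  by (simp add: at0_def prestr_sum)

lemma qx_sum: "qx x (sum f B) = (\<Sum>b\<in>B. qx x (f b))"
  by (induction B rule: infinite_finite_induct) (auto simp: qx_add)

lemma const_coeff_at0: "const_coeff (at0 x p) = const_coeff p"
  by (simp add: const_coeff_def at0_def lookup_prestr)

lemma at0_mcomp: "p \<in> mcomp (sq (insert x X) F) d \<Longrightarrow> at0 x p \<in> mcomp (sq X {e \<in> F. e \<subseteq> X}) d"
  by (fastforce simp: mcomp_def at0_def keys_prestr sq_def monoms_def)

lemma at0_mcomp_monoms: "p \<in> mcomp (monoms (insert x X)) d \<Longrightarrow> at0 x p \<in> mcomp (monoms X) d"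
  by (fastforce simp: mcomp_def at0_def keys_prestr monoms_def)

lemma qx_mcomp: "p \<in> mcomp (monoms (insert x X)) d \<Longrightarrow> qx x p \<in> mcomp (monoms (insert x X)) (d - 1)"
proof -
  assume p: "p \<in> mcomp (monoms (insert x X)) d"
  have "t \<in> monoms (insert x X) \<and> int (mdeg t) = d - 1" if "t \<in> keys (qx x p)" for t
  proof -
    have "single x 1 + t \<in> keys p" using that by (simp add: qx_def in_keys_iff lookup_mdiv)
    then have "single x 1 + t \<in> monoms (insert x X)" "int (mdeg (single x 1 + t)) = d"
      using p by (auto simp: mcomp_def)
    moreover have "mdeg (single x (1::nat)) = 1" by (simp add: mdeg_def)
    ultimately show ?thesis by (simp add: monoms_def keys_add_nat mdeg_add)
  qed
  then show ?thesis by (auto simp: mcomp_def)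
qed

lemma var_mcomp: "x \<in> X \<Longrightarrow> (var x :: ('x, 'k::field) mpoly) \<in> mcomp (monoms X) 1"
  by (simp add: var_def mcomp_def monoms_def mdeg_def)

definition pjoin :: "nat \<Rightarrow> (nat \<Rightarrow> 'm) \<Rightarrow> (nat \<Rightarrow> 'm) \<Rightarrow> nat \<Rightarrow> 'm" where
  "pjoin n f g = (\<lambda>b. if b < n then f b else g (b - n))"

lemma bdR_pjoin_left: "bdR C i (pjoin (rank C (Suc i)) f g) = bdR C i f"
  by (rule bdR_cong) (simp add: pjoin_def)

lemma chains_pjoin:
  assumes "f \<in> chains C (mcomp U) (Suc i) j" "g \<in> chains C (mcomp U) i (j - 1)"
  shows "pjoin (rank C (Suc i)) f g \<in> chains (cone x C) (mcomp U) (Suc i) j"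
  using assms by (auto simp: chains_def pjoin_def cone_def algebra_simps)

locale resolution_cone = resolution X C for X and C :: "('x, 'k::field) free_complex" +
  fixes x :: 'x
  assumes x: "x \<notin> X"
begin

lemma dmat_free: "b < rank C (Suc i) \<Longrightarrow> c < rank C i \<Longrightarrow> keys (dmat C i b c) \<subseteq> {m. x \<notin> keys m}"
  using dmat_R[of b i c] x by (auto simp: mcomp_def monoms_def)

text \<open>\<open>C\<close> is a complex over \<open>X\<close>, so its matrices do not involve
  \<open>x\<close>.\<close>

lemma bdR_at0: "bdR C i (\<lambda>b. at0 x (f b)) = (\<lambda>c. at0 x (bdR C i f c))"
  by (auto simp: bd_def fun_eq_iff at0_sum at0_mult[OF dmat_free] intro!: sum.cong)

lemma bdR_qx: "bdR C i (\<lambda>b. qx x (f b)) = (\<lambda>c. qx x (bdR C i f c))"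
  by (auto simp: bd_def fun_eq_iff qx_sum qx_mult[OF dmat_free] intro!: sum.cong)

text \<open>The extra 1 in the shift of the second block accounts for the degree of the entry
  \<open>var x\<close>.\<close>

lemma dmat_cone:
  assumes "b < rank (cone x C) (Suc i)" "c < rank (cone x C) i"
  shows "dmat (cone x C) i b c
    \<in> mcomp (monoms (insert x X)) (shift (cone x C) (Suc i) b - shift (cone x C) i c)"
proof -
  have mono: "p \<in> mcomp (monoms (insert x X)) d" if "p \<in> mcomp (monoms X) d" for p :: "('x, 'k) mpoly" and d
    using that by (rule mcomp_mono[rotated]) (auto simp: monoms_def)
  consider (1) "b < rank C (Suc i)" "c < rank C i" | (2) "b < rank C (Suc i)" "\<not> c < rank C i"
    | (3) b' where "b = rank C (Suc i) + b'" "b' < rank C i" "c < rank C i"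
    | (4) i' b' c' where "i = Suc i'" "b = rank C (Suc i) + b'" "c = rank C i + c'"
        "b' < rank C (Suc i')" "c' < rank C i'"
  proof -
    show thesis
    proof (cases "b < rank C (Suc i)")
      case True
      then show thesis using 1 2 by blast
    next
      case False
      then have b: "b = rank C (Suc i) + (b - rank C (Suc i))" "b - rank C (Suc i) < rank C i"
        using assms(1) by (auto simp: rank_cone)
      show thesis
      proof (cases "c < rank C i")
        case True
        then show thesis using 3 b by blast
      next
        case c: False
        then obtain i' where i': "i = Suc i'" using assms(2) by (cases i) (auto simp: rank_cone)
        then have "c = rank C i + (c - rank C i)" "c - rank C i < rank C i'"
          using assms(2) c by (auto simp: rank_cone)
        then show thesis using 4 b i' by blast
      qed
    qed
  qed
  then show ?thesis
  proof cases
    case 1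
    then show ?thesis using mono[OF dmat_R[of b i c]] by (simp add: cone_def)
  next
    case 2
    then show ?thesis by (simp add: cone_def)
  next
    case 3
    then show ?thesis by (simp add: cone_def var_mcomp)
  next
    case 4
    then show ?thesis using mono[OF mcomp_uminus[OF dmat_R[of b' i' c']]] by (simp add: cone_def)
  qed
qed

text \<open>The sign in the second block makes the two terms \<open>var x * bdR C i f2 c\<close>
  cancel.\<close>

lemma bd_bd_cone: "bdR (cone x C) i (bdR (cone x C) (Suc i) f) = (\<lambda>_. 0)"
proof
  fix c
  define f2 where "f2 = (\<lambda>b. f (rank C (Suc (Suc i)) + b))"
  define g where "g = bdR (cone x C) (Suc i) f"
  have g1: "g b = bdR C (Suc i) f b + var x * f2 b" if "b < rank C (Suc i)" for b
    using that by (simp add: g_def bd_cone f2_def)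
  have g2: "g (rank C (Suc i) + b) = - bdR C i f2 b" if "b < rank C i" for b
    using that by (simp add: g_def bd_cone f2_def rank_cone)
  have "bdR C i g = bdR C i (\<lambda>b. bdR C (Suc i) f b + var x * f2 b)"
    by (rule bdR_cong) (rule g1)
  then have e1: "bdR C i g = (\<lambda>c. var x * bdR C i f2 c)"
    by (simp add: bdR_add bdR_mult bd_bd)
  have e2: "bdR C i' (\<lambda>b. g (rank C (Suc i) + b)) = (\<lambda>_. 0)" if i': "i = Suc i'" for i'
  proof -
    have "bdR C i' (\<lambda>b. g (rank C (Suc i) + b)) = bdR C i' (\<lambda>b. - bdR C i f2 b)"
      by (rule bdR_cong) (use g2 i' in auto)
    then show ?thesis by (simp add: bdR_uminus bd_bd i')
  qed
  have "bdR (cone x C) i g c = 0"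
  proof (cases "c < rank C i")
    case True
    then show ?thesis by (simp add: bd_cone e1 g2)
  next
    case False
    then show ?thesis using e2 by (cases i) (auto simp: bd_cone rank_cone)
  qed
  then show "bdR (cone x C) i (bdR (cone x C) (Suc i) f) c = 0" by (simp add: g_def)
qed

lemma bd_chains_cone:
  assumes "upset (insert x X) U" "f \<in> chains (cone x C) (mcomp U) (Suc i) j"
  shows "bdR (cone x C) i f \<in> chains (cone x C) (mcomp U) i j"
proof -
  have "dmat (cone x C) i b c * f b \<in> mcomp U (j - shift (cone x C) i c)"
    if "b < rank (cone x C) (Suc i)" "c < rank (cone x C) i" for b c
    using mcomp_mult[OF assms(1) dmat_cone[OF that], of "f b" "j - shift (cone x C) (Suc i) b"] assms(2) that
    by (auto simp: chains_def)
  then show ?thesis by (auto simp: chains_def bd_def intro: mcomp_sum)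
qed

text \<open>The cut-off at \<open>rank C i\<close> discards the second block, since chains of
  \<open>C\<close> vanish beyond its rank.\<close>

lemma chains_at0:
  assumes f: "f \<in> chains (cone x C) (mcomp (monoms (insert x X))) i j"
  shows "(\<lambda>b. if b < rank C i then at0 x (f b) else 0) \<in> chains C (mcomp (monoms X)) i j"
proof -
  have "f b \<in> mcomp (monoms (insert x X)) (j - shift C i b)" if "b < rank C i" for b
  proof -
    have "b < rank (cone x C) i" using that by (cases i) (auto simp: rank_cone)
    then have "f b \<in> mcomp (monoms (insert x X)) (j - shift (cone x C) i b)"
      using f by (simp add: chains_def)
    then show ?thesis using that by (simp add: cone_def)
  qed
  then show ?thesis by (auto simp: chains_def at0_mcomp_monoms)
qed

lemma chains_qx:
  assumes f: "f \<in> chains (cone x C) (mcomp (monoms (insert x X))) i j"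
  shows "(\<lambda>b. if b < rank C i then qx x (f b) else 0) \<in> chains C (mcomp (monoms (insert x X))) i (j - 1)"
proof -
  have "qx x (f b) \<in> mcomp (monoms (insert x X)) (j - 1 - shift C i b)" if "b < rank C i" for b
  proof -
    have "b < rank (cone x C) i" using that by (cases i) (auto simp: rank_cone)
    then have "f b \<in> mcomp (monoms (insert x X)) (j - shift (cone x C) i b)"
      using f by (simp add: chains_def)
    then show ?thesis using that qx_mcomp[of "f b" x X "j - shift C i b"]
      by (simp add: cone_def algebra_simps)
  qed
  then show ?thesis by (auto simp: chains_def)
qed

text \<open>The part of a cycle without \<open>x\<close> is a cycle of the old complex; the quotient by \<open>x\<close> then
  gives the second component of a preimage.\<close>

lemma cone_lift:
  assumes f: "f \<in> chains (cone x C) (mcomp (monoms (insert x X))) i j"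
    and cyc: "\<And>i'. i = Suc i' \<Longrightarrow> bdR (cone x C) i' f = (\<lambda>_. 0)"
    and g: "g \<in> chains C (mcomp (monoms X)) (Suc i) j"
    and fg: "\<And>b. b < rank C i \<Longrightarrow> at0 x (f b) = bdR C i g b"
  shows "f \<in> bdR (cone x C) i ` chains (cone x C) (mcomp (monoms (insert x X))) (Suc i) j"
proof
  define q where "q = (\<lambda>b. if b < rank C i then qx x (f b) else 0)"
  let ?h = "pjoin (rank C (Suc i)) g q"
  have "monoms X \<subseteq> monoms (insert x X)" by (auto simp: monoms_def)
  then have "g \<in> chains C (mcomp (monoms (insert x X))) (Suc i) j" using g by (rule chains_mono)
  then show "?h \<in> chains (cone x C) (mcomp (monoms (insert x X))) (Suc i) j"
    unfolding q_def by (rule chains_pjoin) (rule chains_qx[OF f])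
  show "f = bdR (cone x C) i ?h"
  proof
    fix c
    have right: "(\<lambda>b. ?h (rank C (Suc i) + b)) = q" by (simp add: pjoin_def)
    consider (1) "c < rank C i" | (2) i' c' where "i = Suc i'" "c = rank C i + c'" "c' < rank C i'"
      | (3) "c \<ge> rank (cone x C) i"
    proof (cases i)
      case 0
      then show thesis using 1 3 by (cases "c < rank C i") (auto simp: rank_cone)
    next
      case (Suc i')
      then show thesis using 1 3 2[of i' "c - rank C i"]
        by (cases "c < rank C i"; cases "c < rank C i + rank C i'") (auto simp: rank_cone)
    qed
    then show "f c = bdR (cone x C) i ?h c"
    proof cases
      case 1
      have "bdR (cone x C) i ?h c = bdR C i g c + var x * q c"
        using 1 right by (simp add: bd_cone bdR_pjoin_left fun_eq_iff)
      also have "\<dots> = at0 x (f c) + var x * qx x (f c)" using 1 fg by (simp add: q_def)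
      finally show ?thesis by (simp add: at0_qx)
    next
      case 2
      \<comment> \<open>The first block of the cycle condition. Its quotient by \<open>x\<close>
        expresses the second block of \<open>f\<close> through the boundary of
        \<open>q\<close>.\<close>
      have "bdR C i' f c' + var x * f c = 0"
        using fun_cong[OF cyc[OF 2(1)], of c'] 2 by (simp add: bd_cone)
      then have "qx x (bdR C i' f c') + f c = 0"
        by (metis qx_add qx_var_mult qx_zero)
      moreover have "bdR C i' q = bdR C i' (\<lambda>b. qx x (f b))"
        by (rule bdR_cong) (simp add: q_def 2(1))
      ultimately have "f c = - bdR C i' q c'"
        by (simp add: bdR_qx eq_neg_iff_add_eq_0 add.commute)
      then show ?thesis using 2 right by (simp add: bd_cone rank_cone)
    next
      case 3
      then have "\<not> c < rank C i" by (cases i) (auto simp: rank_cone)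
      then show ?thesis using 3 f by (simp add: chains_def bd_cone)
    qed
  qed
qed

lemma augmentation_cone: "augmentation (cone x C) f = augmentation C f"
  by (simp add: augmentation_def rank_cone) (simp add: cone_def)

lemma augmentation_at0: "augmentation C (\<lambda>b. if b < rank C 0 then at0 x (f b) else 0) = augmentation C f"
  by (simp add: augmentation_def K_smul_def const_coeff_at0)

text \<open>Over the larger ring \<open>C\<close> resolves the polynomial ring in \<open>x\<close>
  alone, on which multiplication by \<open>x\<close> is injective with cokernel the field.
  Concretely, \<open>at0\<close> reduces the claims to those for \<open>C\<close>, and
  \<open>cone_lift\<close> lifts preimages back.\<close>

lemma resolution_cone: "graded_free_resolution_of_K (insert x X) (cone x C)"
  unfolding graded_free_resolution_of_K_def R_comp_eq
proof (intro conjI allI impI)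
  fix i b c assume "b < rank (cone x C) (Suc i)" "c < rank (cone x C) i"
  then show "dmat (cone x C) i b c
    \<in> mcomp (monoms (insert x X)) (shift (cone x C) (Suc i) b - shift (cone x C) i c)"
    by (rule dmat_cone)
next
  fix b assume "b < rank (cone x C) 0"
  then show "aug (cone x C) b \<in> K_comp (shift (cone x C) 0 b)"
    using res by (simp add: graded_free_resolution_of_K_def rank_cone) (simp add: cone_def)
next
  fix i j
  show "cycles (cone x C) (*) (mcomp (monoms (insert x X))) (Suc i) j
    = boundaries (cone x C) (*) (mcomp (monoms (insert x X))) (Suc i) j"
  proof (intro equalityI subsetI)
    fix f assume "f \<in> cycles (cone x C) (*) (mcomp (monoms (insert x X))) (Suc i) j"
    then have f: "f \<in> chains (cone x C) (mcomp (monoms (insert x X))) (Suc i) j"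
      and cyc: "bdR (cone x C) i f = (\<lambda>_. 0)" by (auto simp: cycles_iff)
    define p where "p = (\<lambda>b. if b < rank C (Suc i) then at0 x (f b) else 0)"
    have "bdR C i p = bdR C i (\<lambda>b. at0 x (f b))" by (rule bdR_cong) (simp add: p_def)
    then have bdp: "bdR C i p = (\<lambda>c. at0 x (bdR C i f c))" by (simp add: bdR_at0)
    \<comment> \<open>Setting \<open>x\<close> to zero removes the contribution of the second block,
      so the truncated first block is a cycle of \<open>C\<close>.\<close>
    have "bdR C i p = (\<lambda>_. 0)"
    proof
      fix c
      show "bdR C i p c = 0"
      proof (cases "c < rank C i")
        case True
        then have "bdR C i f c + var x * f (rank C (Suc i) + c) = 0"
          using fun_cong[OF cyc, of c] by (simp add: bd_cone)
        then show ?thesis unfolding bdp by (metis at0_add at0_var_mult at0_zero add.right_neutral)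
      qed (simp add: bd_def)
    qed
    moreover have "p \<in> chains C (mcomp (monoms X)) (Suc i) j"
      unfolding p_def by (rule chains_at0[OF f])
    ultimately have "p \<in> cycles C (*) (mcomp (monoms X)) (Suc i) j" by (simp add: cycles_iff)
    then obtain g where g: "g \<in> chains C (mcomp (monoms X)) (Suc (Suc i)) j" "p = bdR C (Suc i) g"
      unfolding cycles_eq boundaries_def by blast
    show "f \<in> boundaries (cone x C) (*) (mcomp (monoms (insert x X))) (Suc i) j"
      unfolding boundaries_def
    proof (rule cone_lift[OF f _ g(1)])
      show "bdR (cone x C) i' f = (\<lambda>_. 0)" if "Suc i = Suc i'" for i' using cyc that by simp
      show "at0 x (f b) = bdR C (Suc i) g b" if "b < rank C (Suc i)" for b
        using fun_cong[OF g(2), of b] that by (simp add: p_def)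
    qed
  next
    fix f assume "f \<in> boundaries (cone x C) (*) (mcomp (monoms (insert x X))) (Suc i) j"
    then show "f \<in> cycles (cone x C) (*) (mcomp (monoms (insert x X))) (Suc i) j"
      using bd_chains_cone[OF upset_monoms] bd_bd_cone by (auto simp: boundaries_def cycles_iff)
  qed
next
  fix j
  have aug0: "{f \<in> chains C (mcomp (monoms X)) 0 j. augmentation C f = 0} = boundaries C (*) (mcomp (monoms X)) 0 j"
    using res by (simp add: graded_free_resolution_of_K_def R_comp_eq)
  show "{f \<in> chains (cone x C) (mcomp (monoms (insert x X))) 0 j. augmentation (cone x C) f = 0}
    = boundaries (cone x C) (*) (mcomp (monoms (insert x X))) 0 j"
  proof (intro equalityI subsetI)
    fix f assume "f \<in> {f \<in> chains (cone x C) (mcomp (monoms (insert x X))) 0 j. augmentation (cone x C) f = 0}"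
    then have f: "f \<in> chains (cone x C) (mcomp (monoms (insert x X))) 0 j" and "augmentation C f = 0"
      by (auto simp: augmentation_cone)
    then have "(\<lambda>b. if b < rank C 0 then at0 x (f b) else 0) \<in> boundaries C (*) (mcomp (monoms X)) 0 j"
      unfolding aug0[symmetric] using chains_at0[OF f] by (simp add: augmentation_at0)
    then obtain g where g: "g \<in> chains C (mcomp (monoms X)) (Suc 0) j"
        "(\<lambda>b. if b < rank C 0 then at0 x (f b) else 0) = bdR C 0 g"
      by (auto simp: boundaries_def)
    show "f \<in> boundaries (cone x C) (*) (mcomp (monoms (insert x X))) 0 j"
      unfolding boundaries_def
    proof (rule cone_lift[OF f _ g(1)])
      show "at0 x (f b) = bdR C 0 g b" if "b < rank C 0" for b
        using fun_cong[OF g(2), of b] that by simp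
    qed simp
  next
    fix f assume "f \<in> boundaries (cone x C) (*) (mcomp (monoms (insert x X))) 0 j"
    then obtain h where h: "h \<in> chains (cone x C) (mcomp (monoms (insert x X))) (Suc 0) j"
        "f = bdR (cone x C) 0 h" by (auto simp: boundaries_def)
    \<comment> \<open>The augmentation sees constant terms only, so it may be computed after setting
      \<open>x\<close> to zero, where \<open>f\<close> becomes a boundary of
      \<open>C\<close>.\<close>
    define p where "p = (\<lambda>b. if b < rank C (Suc 0) then at0 x (h b) else 0)"
    have "bdR C 0 p = bdR C 0 (\<lambda>b. at0 x (h b))" by (rule bdR_cong) (simp add: p_def)
    then have bdp: "bdR C 0 p = (\<lambda>c. at0 x (bdR C 0 h c))" by (simp add: bdR_at0)
    have "p \<in> chains C (mcomp (monoms X)) (Suc 0) j" unfolding p_def by (rule chains_at0[OF h(1)])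
    then have "bdR C 0 p \<in> boundaries C (*) (mcomp (monoms X)) 0 j" by (auto simp: boundaries_def)
    then have "augmentation C (bdR C 0 p) = 0" unfolding aug0[symmetric] by simp
    moreover have "bdR C 0 p = (\<lambda>b. if b < rank C 0 then at0 x (f b) else 0)"
      unfolding bdp h(2) by (auto simp: fun_eq_iff bd_cone at0_add at0_var_mult) (simp add: bd_def)
    ultimately have "augmentation C f = 0" by (simp add: augmentation_at0)
    then show "f \<in> {f \<in> chains (cone x C) (mcomp (monoms (insert x X))) 0 j. augmentation (cone x C) f = 0}"
      using bd_chains_cone[OF upset_monoms h(1)] h(2) by (simp add: augmentation_cone)
  qed
next
  fix j
  have img: "augmentation C ` chains C (mcomp (monoms X)) 0 j = K_comp j"
    using res by (simp add: graded_free_resolution_of_K_def R_comp_eq)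
  show "augmentation (cone x C) ` chains (cone x C) (mcomp (monoms (insert x X))) 0 j = K_comp j"
  proof (intro equalityI subsetI)
    fix a assume "a \<in> augmentation (cone x C) ` chains (cone x C) (mcomp (monoms (insert x X))) 0 j"
    then obtain f where f: "f \<in> chains (cone x C) (mcomp (monoms (insert x X))) 0 j" "a = augmentation C f"
      by (auto simp: augmentation_cone)
    then have "a = augmentation C (\<lambda>b. if b < rank C 0 then at0 x (f b) else 0)"
      by (simp add: augmentation_at0)
    then show "a \<in> K_comp j" unfolding img[symmetric] using chains_at0[OF f(1)] by blast
  next
    fix a assume "a \<in> (K_comp j :: 'k set)"
    then obtain f where f: "f \<in> chains C (mcomp (monoms X)) 0 j" "a = augmentation C f"
      unfolding img[symmetric] by blast
    have "monoms X \<subseteq> monoms (insert x X)" by (auto simp: monoms_def)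
    then have "f \<in> chains C (mcomp (monoms (insert x X))) 0 j" using f(1) by (rule chains_mono)
    then have "f \<in> chains (cone x C) (mcomp (monoms (insert x X))) 0 j"
      by (simp add: chains_def cone_def)
    then show "a \<in> augmentation (cone x C) ` chains (cone x C) (mcomp (monoms (insert x X))) 0 j"
      using f(2) by (auto simp: augmentation_cone)
  qed
qed

text \<open>Setting \<open>x\<close> to zero turns a boundary of the cone into a boundary of the old complex.\<close>

lemma not_van_cone:
  assumes "\<not> van C (sq X {e \<in> F. e \<subseteq> X}) i j"
  shows "\<not> van (cone x C) (sq (insert x X) F) i j"
proof
  assume van: "van (cone x C) (sq (insert x X) F) i j"
  let ?U = "sq X {e \<in> F. e \<subseteq> X}"
  have sub: "?U \<subseteq> sq (insert x X) F" by (auto simp: sq_def monoms_def)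
  have "van C ?U i j"
  proof (rule vanI)
    fix z assume z: "z \<in> chains C (mcomp ?U) i j" and cyc: "\<And>i'. i = Suc i' \<Longrightarrow> bdR C i' z = (\<lambda>_. 0)"
    have out: "z b = 0" if "b \<ge> rank C i" for b using z that by (auto simp: chains_def)
    have "z \<in> chains (cone x C) (mcomp (sq (insert x X) F)) i j"
    proof -
      have "z b \<in> mcomp (sq (insert x X) F) (j - shift (cone x C) i b)" for b
      proof (cases "b < rank C i")
        case True
        then have "z b \<in> mcomp ?U (j - shift C i b)" using z by (simp add: chains_def)
        then have "z b \<in> mcomp (sq (insert x X) F) (j - shift C i b)" by (rule mcomp_mono[OF sub])
        then show ?thesis using True by (simp add: cone_def)
      qed (simp add: out)
      moreover have "z b = 0" if "b \<ge> rank (cone x C) i" for b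
        using that by (intro out) (cases i; simp add: rank_cone)
      ultimately show ?thesis by (simp add: chains_def)
    qed
    moreover have "bdR (cone x C) i' z = (\<lambda>_. 0)" if i': "i = Suc i'" for i'
    proof
      fix c
      show "bdR (cone x C) i' z c = 0"
        using cyc[OF i'] out i' by (simp add: bd_cone)
    qed
    ultimately obtain w where w: "w \<in> chains (cone x C) (mcomp (sq (insert x X) F)) (Suc i) j"
        "z = bdR (cone x C) i w"
      using vanD[OF van] by blast
    define g where "g = (\<lambda>b. if b < rank C (Suc i) then at0 x (w b) else 0)"
    have "g \<in> chains C (mcomp ?U) (Suc i) j"
    proof -
      have "at0 x (w b) \<in> mcomp ?U (j - shift C (Suc i) b)" if "b < rank C (Suc i)" for b
      proof (rule at0_mcomp)
        have "w b \<in> mcomp (sq (insert x X) F) (j - shift (cone x C) (Suc i) b)"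
          using w(1) that by (simp add: chains_def rank_cone)
        then show "w b \<in> mcomp (sq (insert x X) F) (j - shift C (Suc i) b)"
          using that by (simp add: cone_def)
      qed
      then show ?thesis by (simp add: g_def chains_def)
    qed
    moreover have "z = bdR C i g"
    proof
      fix c
      have "bdR C i g = bdR C i (\<lambda>b. at0 x (w b))" by (rule bdR_cong) (simp add: g_def)
      then have g: "bdR C i g c = at0 x (bdR C i w c)" by (simp add: bdR_at0)
      show "z c = bdR C i g c"
      proof (cases "c < rank C i")
        case True
        then have "z c \<in> mcomp ?U (j - shift C i c)" using z by (simp add: chains_def)
        then have "keys (z c) \<subseteq> {m. x \<notin> keys m}" using x by (auto simp: mcomp_def sq_def monoms_def)
        then have "z c = at0 x (z c)" by (simp add: at0_free)
        also have "\<dots> = at0 x (bdR C i w c + var x * w (rank C (Suc i) + c))"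
          using w(2) True by (simp add: bd_cone)
        also have "\<dots> = bdR C i g c" by (simp add: at0_add at0_var_mult g)
        finally show ?thesis .
      next
        case False
        then show ?thesis using out by (simp add: bd_def)
      qed
    qed
    ultimately show "\<exists>g\<in>chains C (mcomp ?U) (Suc i) j. z = bdR C i g" by blast
  qed
  then show False using assms by blast
qed

end

section \<open>Existence of resolutions and enlargement of the variable set\<close>

lemma resolution_empty:
  "graded_free_resolution_of_K {} (\<lparr>rank = \<lambda>i. if i = 0 then 1 else 0, shift = \<lambda>_ _. 0,
     dmat = \<lambda>_ _ _. 0, aug = \<lambda>_. 1\<rparr> :: ('x, 'k::field) free_complex)"
  (is "graded_free_resolution_of_K {} ?C")
proof -
  \<comment> \<open>Without variables the only monomial is 1, so the ring is the field, which
    resolves itself in homological degree 0.\<close>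
  have m: "monoms {} = {0}" by (auto simp: monoms_def)
  have ch: "chains ?C (mcomp (monoms {})) (Suc i) j = {\<lambda>_. 0}" for i j
    by (auto simp: chains_def)
  have bd0: "bdR ?C i f = (\<lambda>_. 0)" for i f by (auto simp: bd_def)
  have p: "p = single 0 (const_coeff p)" if "p \<in> mcomp (monoms {}) d" for p :: "('x, 'k) mpoly" and d
    using that by (intro poly_mapping_eqI) (auto simp: mcomp_def m const_coeff_def lookup_single when_def in_keys_iff subset_iff)
  have aug: "augmentation ?C f = const_coeff (f 0)" for f
    by (simp add: augmentation_def K_smul_def)
  have "const_coeff p \<in> K_comp d" if "p \<in> mcomp (monoms {}) d" for p :: "('x, 'k) mpoly" and d
    using that by (auto simp: K_comp_def mcomp_def m const_coeff_def in_keys_iff subset_iff)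
  moreover have "a \<in> augmentation ?C ` chains ?C (mcomp (monoms {})) 0 j" if "a \<in> K_comp j" for a j
  proof
    show "a = augmentation ?C (\<lambda>b. if b = 0 then single 0 a else 0)"
      unfolding aug by (simp add: const_coeff_def)
    show "(\<lambda>b. if b = 0 then single 0 a else 0) \<in> chains ?C (mcomp (monoms {})) 0 j"
      using that by (auto simp: chains_def mcomp_def m K_comp_def split: if_splits)
  qed
  ultimately have img: "augmentation ?C ` chains ?C (mcomp (monoms {})) 0 j = K_comp j" for j
    unfolding aug by (auto simp: chains_def)
  have ker: "{f \<in> chains ?C (mcomp (monoms {})) 0 j. augmentation ?C f = 0} = {\<lambda>_. 0}" for j
  proof (intro equalityI subsetI)
    fix f assume "f \<in> {f \<in> chains ?C (mcomp (monoms {})) 0 j. augmentation ?C f = 0}"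
    then have f: "f \<in> chains ?C (mcomp (monoms {})) 0 j" "const_coeff (f 0) = 0"
      by (auto simp: aug)
    then have "f 0 = 0" using p[of "f 0" j] by (simp add: chains_def)
    then have "f b = 0" for b using f(1) by (cases b) (auto simp: chains_def)
    then show "f \<in> {\<lambda>_. 0}" by auto
  qed (auto simp: aug const_coeff_def)
  show ?thesis
    unfolding graded_free_resolution_of_K_def R_comp_eq img ker boundaries_def bd0
    by (auto simp: cycles_iff ch bd0 K_comp_def image_constant_conv)
qed

lemma ex_resolution:
  assumes "finite X"
  shows "\<exists>C :: ('x, 'k::field) free_complex. graded_free_resolution_of_K X C"
  using assms
proof (induction X rule: finite_induct)
  case empty
  then show ?case using resolution_empty by blast
next
  case (insert x X)
  then obtain C :: "('x, 'k) free_complex" where C: "graded_free_resolution_of_K X C" by blast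
  then interpret resolution_cone X C x using insert.hyps by unfold_locales
  show ?case using resolution_cone by blast
qed

text \<open>Passes from an induced subgraph to the whole graph, one vertex at a time. The resolution
  changes at every step, hence the existential over \<open>C'\<close>.\<close>

lemma ex_not_van_superset:
  fixes C :: "('x, 'k::field) free_complex"
  assumes "graded_free_resolution_of_K W C" "\<not> van C (sq W {e \<in> F. e \<subseteq> W}) i j"
    and "finite Y" "W \<inter> Y = {}"
  shows "\<exists>C' :: ('x, 'k) free_complex. graded_free_resolution_of_K (W \<union> Y) C' \<and>
    \<not> van C' (sq (W \<union> Y) {e \<in> F. e \<subseteq> W \<union> Y}) i j"
  using assms(3,4)
proof (induction Y rule: finite_induct)
  case empty
  then show ?case using assms by auto
next
  case (insert x Y)
  then obtain C' :: "('x, 'k) free_complex" where C': "graded_free_resolution_of_K (W \<union> Y) C'"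
      "\<not> van C' (sq (W \<union> Y) {e \<in> F. e \<subseteq> W \<union> Y}) i j"
    by auto
  from C'(1) interpret resolution_cone "W \<union> Y" C' x
    using insert.hyps insert.prems by unfold_locales auto
  have "{e \<in> {e \<in> F. e \<subseteq> insert x (W \<union> Y)}. e \<subseteq> W \<union> Y} = {e \<in> F. e \<subseteq> W \<union> Y}" by auto
  then have "\<not> van (cone x C') (sq (insert x (W \<union> Y)) {e \<in> F. e \<subseteq> insert x (W \<union> Y)}) i j"
    using C'(2) by (intro not_van_cone) simp
  then show ?case using resolution_cone by auto
qed

subsection \<open>Edge ideals\<close>

lemma polys_iff: "p \<in> polys X \<longleftrightarrow> keys p \<subseteq> monoms X"
  by (auto simp: polys_def monoms_def)

lemma polys_mult: "p \<in> polys X \<Longrightarrow> q \<in> polys X \<Longrightarrow> p * q \<in> (polys X :: ('x, 'k::field) mpoly set)"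
  using keys_mult[of p q] by (fastforce simp: polys_def keys_add_nat)

lemma ring_poly_ring: "ring (poly_ring X :: ('x, 'k::field) mpoly ring)"
proof (rule ringI)
  show "abelian_group (poly_ring X :: ('x, 'k) mpoly ring)"
  proof (rule abelian_groupI)
    fix p :: "('x, 'k) mpoly" assume "p \<in> carrier (poly_ring X :: ('x, 'k) mpoly ring)"
    then show "\<exists>q\<in>carrier (poly_ring X). q \<oplus>\<^bsub>poly_ring X\<^esub> p = \<zero>\<^bsub>poly_ring X\<^esub>"
      by (intro bexI[of _ "- p"]) (auto simp: poly_ring_def polys_def keys_uminus_ring)
  next
    fix p q :: "('x, 'k) mpoly" assume "p \<in> carrier (poly_ring X :: ('x, 'k) mpoly ring)" "q \<in> carrier (poly_ring X)"
    then show "p \<oplus>\<^bsub>poly_ring X\<^esub> q \<in> carrier (poly_ring X)"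
      using keys_add[of p q] by (auto simp: poly_ring_def polys_def)
  qed (auto simp: poly_ring_def polys_def add.assoc add.commute)
  show "monoid (poly_ring X :: ('x, 'k) mpoly ring)"
    by (rule monoidI) (auto simp: poly_ring_def polys_mult mult.assoc, auto simp: polys_def)
qed (auto simp: poly_ring_def algebra_simps)

lemma sum_single_lookup:
  assumes "finite K" "keys p \<subseteq> K"
  shows "(\<Sum>m\<in>K. single m (lookup p m)) = p"
  using assms by (intro poly_mapping_eqI) (auto simp: lookup_sum lookup_single when_def in_keys_iff)

text \<open>Polynomials whose terms are all divisible by edges form an ideal containing the
  generators. Conversely, each such term is a multiple of a generator and so lies in every ideal
  containing them.\<close>

lemma edge_ideal_eq:
  assumes "fin_simple_graph X E"
  shows "(edge_ideal X E :: ('x, 'k::field) mpoly set) = {p. keys p \<subseteq> sq X E}"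
proof
  let ?R = "poly_ring X :: ('x, 'k) mpoly ring"
  let ?S = "{var u * var v | u v. {u, v} \<in> E} :: ('x, 'k) mpoly set"
  have E: "e \<subseteq> X" "card e = 2" if "e \<in> E" for e
    using assms that by (auto simp: fin_simple_graph_def)
  have gen: "var u * var v = (mon (sqm {u, v}) :: ('x, 'k) mpoly)" if "{u, v} \<in> E" for u v
  proof -
    have "u \<noteq> v" using E(2)[OF that] by auto
    then show ?thesis by (simp add: var_def mult_single sqm_def)
  qed
  have up: "keys (p * q) \<subseteq> sq X E" if "keys p \<subseteq> monoms X" "keys q \<subseteq> sq X E" for p q :: "('x, 'k) mpoly"
  proof
    fix m assume "m \<in> keys (p * q)"
    then obtain a b where "m = a + b" "a \<in> keys p" "b \<in> keys q"
      using keys_mult[of p q] by blast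
    then show "m \<in> sq X E" using that upset_sq[of X E] unfolding upset_def by (metis add.commute subsetD)
  qed
  have "ideal {p. keys p \<subseteq> sq X E} ?R"
  proof (rule idealI[OF ring_poly_ring])
    show "subgroup {p. keys p \<subseteq> sq X E} (add_monoid ?R)"
    proof (rule group.subgroupI)
      show "group (add_monoid ?R)"
        using abelian_group.a_group ring.is_abelian_group ring_poly_ring by blast
      show "{p. keys p \<subseteq> sq X E} \<subseteq> carrier (add_monoid ?R)"
        by (auto simp: poly_ring_def polys_iff sq_def)
      show "{p :: ('x, 'k) mpoly. keys p \<subseteq> sq X E} \<noteq> {}" by (auto intro!: exI[of _ 0])
      fix p :: "('x, 'k) mpoly" assume p: "p \<in> {p. keys p \<subseteq> sq X E}"
      then have "p \<in> carrier ?R" "- p \<in> carrier ?R"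
        by (auto simp: poly_ring_def polys_iff keys_uminus_ring sq_def)
      then have "inv\<^bsub>add_monoid ?R\<^esub> p = - p"
        using abelian_group.minus_equality[OF ring.is_abelian_group[OF ring_poly_ring], of X "- p" p]
        by (simp add: a_inv_def poly_ring_def)
      then show "inv\<^bsub>add_monoid ?R\<^esub> p \<in> {p. keys p \<subseteq> sq X E}" using p by (simp add: keys_uminus_ring)
      fix q :: "('x, 'k) mpoly" assume "q \<in> {p. keys p \<subseteq> sq X E}"
      then show "p \<otimes>\<^bsub>add_monoid ?R\<^esub> q \<in> {p. keys p \<subseteq> sq X E}"
        using p keys_add[of p q] by (auto simp: poly_ring_def)
    qed
  next
    fix p q :: "('x, 'k) mpoly" assume "p \<in> {p. keys p \<subseteq> sq X E}" "q \<in> carrier ?R"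
    then have "keys (q * p) \<subseteq> sq X E" using up[of q p] by (simp add: poly_ring_def polys_iff)
    then show "q \<otimes>\<^bsub>?R\<^esub> p \<in> {p. keys p \<subseteq> sq X E}" "p \<otimes>\<^bsub>?R\<^esub> q \<in> {p. keys p \<subseteq> sq X E}"
      by (simp_all add: poly_ring_def mult.commute)
  qed
  moreover have "?S \<subseteq> {p. keys p \<subseteq> sq X E}"
  proof -
    have "u \<in> X" "v \<in> X" if "{u, v} \<in> E" for u v using E(1)[OF that] by auto
    then show ?thesis by (auto simp: gen keys_sqm sq_def monoms_def)
  qed
  ultimately show "edge_ideal X E \<subseteq> {p :: ('x, 'k) mpoly. keys p \<subseteq> sq X E}"
    unfolding edge_ideal_def genideal_def by blast
  show "{p :: ('x, 'k) mpoly. keys p \<subseteq> sq X E} \<subseteq> edge_ideal X E"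
    unfolding edge_ideal_def genideal_def
  proof (intro subsetI InterI)
    fix p :: "('x, 'k) mpoly" and I
    assume p: "p \<in> {p. keys p \<subseteq> sq X E}" and "I \<in> {I. ideal I ?R \<and> ?S \<subseteq> I}"
    then interpret ideal I ?R by simp
    have S: "?S \<subseteq> I" using \<open>I \<in> {I. ideal I ?R \<and> ?S \<subseteq> I}\<close> by simp
    have single: "single m c \<in> I" if m: "m \<in> sq X E" for m and c :: 'k
    proof -
      obtain e where e: "e \<in> E" "e \<subseteq> keys m" "m \<in> monoms X" using m by (auto simp: sq_def)
      obtain u v where uv: "e = {u, v}" using E(2)[OF e(1)] by (auto simp: card_2_iff)
      obtain t where t: "m = sqm {u, v} + t"
        using range_sqm_iff[of "{u, v}" m] e(2) uv by auto
      have "t \<in> monoms X" using e(3) by (auto simp: t monoms_def keys_add_nat)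
      then have "single t c \<in> carrier ?R" by (auto simp: poly_ring_def polys_iff)
      moreover have "var u * var v \<in> I" using S e(1) uv by blast
      ultimately have "single t c * (var u * var v) \<in> I"
        using I_l_closed[of "var u * var v" "single t c"] by (simp add: poly_ring_def)
      moreover have "single t c * (var u * var v) = single m c"
        using gen[of u v] e(1) uv by (simp add: mult_single t add.commute)
      ultimately show ?thesis by simp
    qed
    have "(\<Sum>m\<in>K. single m (lookup p m)) \<in> I" if "finite K" "K \<subseteq> sq X E" for K
      using that
    proof (induction K rule: finite_induct)
      case empty
      then show ?case using additive_subgroup.zero_closed[OF additive_subgroup_axioms] by (simp add: poly_ring_def)
    next
      case (insert m K)
      then show ?case using additive_subgroup.a_closed[OF additive_subgroup_axioms single, of m "\<Sum>m\<in>K. single m (lookup p m)"]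
        by (simp add: poly_ring_def)
    qed
    then have "(\<Sum>m\<in>keys p. single m (lookup p m)) \<in> I" using p by simp
    then show "p \<in> I" by (simp add: sum_single_lookup)
  qed
qed

text \<open>Boundaries are cycles by \<open>bd_bd\<close>, so equality of the two amounts to the
  single inclusion in \<open>van\<close>.\<close>

lemma (in resolution) Tor_iff_not_van:
  "upset X U \<Longrightarrow> cycles C (*) (mcomp U) i j \<noteq> boundaries C (*) (mcomp U) i j \<longleftrightarrow> \<not> van C U i j"
  using bd_chains[of U] bd_bd by (auto simp: van_def cycles_iff boundaries_def)

lemma reg_le_edge_ideal:
  fixes C :: "('x, 'k::field) free_complex" and lev :: "'x \<Rightarrow> nat"
  assumes "fin_simple_graph X E" "\<And>ps. oseq E lev X ps \<Longrightarrow> length ps \<le> r"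
    and "graded_free_resolution_of_K X C"
  shows "reg_le C (sq X E) (int r + 1)"
proof -
  interpret resolution X C using assms(3) by unfold_locales
  have "edges_in E X = E" using assms(1) by (auto simp: edges_in_def fin_simple_graph_def)
  then show ?thesis
    using reg_le_edges[of X E lev r] assms(1,2) by (simp add: fin_simple_graph_def)
qed

lemma induced_matching_not_van:
  assumes X: "fin_simple_graph X E" and M: "induced_matching E M" "M \<noteq> {}"
  shows "\<exists>C :: ('x, 'k::field) free_complex. graded_free_resolution_of_K X C \<and>
    \<not> van C (sq X E) (card M - 1) (2 * int (card M))"
proof -
  have E: "e \<subseteq> X" "card e = 2" if "e \<in> E" for e
    using X that by (auto simp: fin_simple_graph_def)
  have ME: "M \<subseteq> E" using M by (auto simp: induced_matching_def matching_def)
  have fin: "finite X" using X by (simp add: fin_simple_graph_def)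
  define W where "W = \<Union>M"
  have WX: "W \<subseteq> X" using ME E(1) by (auto simp: W_def)
  have "M \<subseteq> Pow X" using ME E(1) by blast
  then have finM: "finite M" using fin finite_subset by blast
  \<comment> \<open>Here inducedness enters: on the vertices of \<open>M\<close> alone the edge
    ideal is that of pairwise disjoint edges.\<close>
  have MW: "{e \<in> E. e \<subseteq> W} = M"
    using M(1) ME by (auto simp: induced_matching_def W_def)
  obtain C0 :: "('x, 'k) free_complex" where C0: "graded_free_resolution_of_K W C0"
    using ex_resolution[of W] finite_subset[OF WX fin] by blast
  interpret resolution W C0 using C0 by unfold_locales
  have "\<not> van C0 (sq W M) (card M - 1) (2 * int (card M))"
  proof -
    have "e \<subseteq> W \<and> card e = 2" if "e \<in> M" for e using that ME E(2) by (auto simp: W_def)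
    moreover have "e \<inter> f = {}" if "e \<in> M" "f \<in> M" "e \<noteq> f" for e f
      using M(1) that by (auto simp: induced_matching_def matching_def)
    ultimately show ?thesis using reg_le_disjoint_edges[OF finM] M(2) by blast
  qed
  then have "\<exists>C :: ('x, 'k) free_complex. graded_free_resolution_of_K (W \<union> (X - W)) C \<and>
    \<not> van C (sq (W \<union> (X - W)) {e \<in> E. e \<subseteq> W \<union> (X - W)}) (card M - 1) (2 * int (card M))"
    using fin by (intro ex_not_van_superset[OF C0]) (auto simp: MW)
  moreover have "W \<union> (X - W) = X" "{e \<in> E. e \<subseteq> X} = E" using WX E(1) by auto
  ultimately show ?thesis by simp
qed

text \<open>The upper bound holds for every resolution and the lower bound exhibits one, which fits
  the existential quantifier in \<open>Tor_nonzero\<close>.\<close>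

theorem reg_edge_ideal_eq:
  fixes lev :: "'x \<Rightarrow> nat"
  assumes X: "fin_simple_graph X E" and ord: "\<And>ps. oseq E lev X ps \<Longrightarrow> length ps \<le> r"
    and M: "induced_matching E M" "card M = r" "1 \<le> r"
  shows "ideal_reg X (edge_ideal X E :: ('x, 'k::field) mpoly set) = int r + 1"
    and "ind_match E = r"
proof -
  have bounds: "1 \<le> j - int i \<and> j - int i \<le> int r + 1"
    if C: "graded_free_resolution_of_K X C" and nv: "\<not> van C (sq X E) i j"
    for C :: "('x, 'k) free_complex" and i j
  proof -
    interpret resolution X C using C by unfold_locales
    show ?thesis using reg_le_edge_ideal[OF X ord C] nv reg_leD by (meson not_le)
  qed
  let ?A = "{j - int i | i j. Tor_nonzero X (*) (mcomp (sq X E) :: int \<Rightarrow> ('x, 'k) mpoly set) i j}"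
  have Tor: "Tor_nonzero X (*) (mcomp (sq X E) :: int \<Rightarrow> ('x, 'k) mpoly set) i j \<longleftrightarrow>
    (\<exists>C :: ('x, 'k) free_complex. graded_free_resolution_of_K X C \<and> \<not> van C (sq X E) i j)" for i j
    unfolding Tor_nonzero_def
    using resolution.Tor_iff_not_van[OF resolution.intro upset_sq] by blast
  have sub: "?A \<subseteq> {1..int r + 1}" using bounds by (auto simp: Tor)
  have "M \<noteq> {}" using M(2,3) by auto
  from induced_matching_not_van[OF X M(1) this]
  have "Tor_nonzero X (*) (mcomp (sq X E) :: int \<Rightarrow> ('x, 'k) mpoly set) (r - 1) (2 * int r)"
    by (auto simp: Tor M(2))
  moreover have "int r + 1 = 2 * int r - int (r - 1)" using M(3) by simp
  ultimately have mem: "int r + 1 \<in> ?A" by blast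
  have "finite ?A" by (rule finite_subset[OF sub]) simp
  moreover have "y \<le> int r + 1" if "y \<in> ?A" for y using subsetD[OF sub that] by simp
  ultimately have "Max ?A = int r + 1" using mem by (rule Max_eqI)
  moreover have "(\<lambda>d. {p \<in> edge_ideal X E. homogeneous d p}) = (mcomp (sq X E) :: int \<Rightarrow> ('x, 'k) mpoly set)"
    by (simp add: edge_ideal_eq[OF X] mcomp_homogeneous fun_eq_iff)
  ultimately show "ideal_reg X (edge_ideal X E :: ('x, 'k) mpoly set) = int r + 1"
    by (simp only: ideal_reg_def regularity_def)
  \<comment> \<open>A nonempty induced matching realizes the value \<open>card M' + 1\<close> of
    \<open>j - i\<close>, which \<open>bounds\<close> limits to \<open>r + 1\<close>.\<close>
  have "card M' \<le> r" if M': "induced_matching E M'" for M'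
  proof (cases "M' = {}")
    case False
    have "finite E" using X finite_subset[of E "Pow X"] by (auto simp: fin_simple_graph_def)
    then have "finite M'" using M' finite_subset by (auto simp: induced_matching_def matching_def)
    then have "1 \<le> card M'" using False by (simp add: Suc_le_eq card_gt_0_iff)
    moreover obtain C :: "('x, 'k) free_complex" where "graded_free_resolution_of_K X C"
        "\<not> van C (sq X E) (card M' - 1) (2 * int (card M'))"
      using induced_matching_not_van[OF X M' False] by blast
    ultimately show ?thesis using bounds[of C "card M' - 1" "2 * int (card M')"] by simp
  qed simp
  then show "ind_match E = r"
    unfolding ind_match_def using M(1,2)
    by (intro Max_eqI) (auto intro: finite_subset[of _ "{..r}"])
qed


subsection \<open>Matchings\<close>

text \<open>Disjointness is automatic: a vertex shared by the pairs \<open>i\<close> and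
  \<open>j\<close> would turn one of the two edges into a pair forbidden by \<open>aa\<close> or
  \<open>ba\<close>.\<close>

lemma ordered_matchingI:
  assumes E: "\<And>e. e \<in> E \<Longrightarrow> card e = 2" and r: "1 \<le> r"
    and ab: "\<And>i. i \<in> {1..r} \<Longrightarrow> {a i, b i} \<in> E"
    and aa: "\<And>i j. i \<in> {1..r} \<Longrightarrow> j \<in> {1..r} \<Longrightarrow> j < i \<Longrightarrow> {a i, a j} \<notin> E"
    and ba: "\<And>i j. i \<in> {1..r} \<Longrightarrow> j \<in> {1..r} \<Longrightarrow> j < i \<Longrightarrow> {a i, b j} \<notin> E"
  shows "\<exists>M. ordered_matching E M \<and> card M = r"
proof (intro exI conjI)
  define M where "M = {{a i, b i} | i. i \<in> {1..r}}"
  have M: "M = (\<lambda>i. {a i, b i}) ` {1..r}" by (auto simp: M_def)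
  have disj: "{a i, b i} \<inter> {a j, b j} = {}" if "i \<in> {1..r}" "j \<in> {1..r}" "j < i" for i j
    using aa[OF that] ba[OF that] ab[OF that(1)] ab[OF that(2)]
    by (auto simp: insert_commute)
  have disj': "{a i, b i} \<inter> {a j, b j} = {}" if "i \<in> {1..r}" "j \<in> {1..r}" "i \<noteq> j" for i j
    using disj[of i j] disj[of j i] that by (cases "i < j") auto
  have "inj_on (\<lambda>i. {a i, b i}) {1..r}"
    using disj' by (fastforce intro!: inj_onI)
  then show card: "card M = r" unfolding M by (simp add: card_image)
  have "independent E (a ` {1..r})"
    unfolding independent_def
  proof (intro ballI)
    fix x y assume "x \<in> a ` {1..r}" "y \<in> a ` {1..r}"
    then obtain i j where ij: "x = a i" "y = a j" "i \<in> {1..r}" "j \<in> {1..r}" by blast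
    show "{x, y} \<notin> E"
    proof (cases i j rule: linorder_cases)
      case equal
      then show ?thesis using E[of "{x, y}"] ij by auto
    qed (use aa[of i j] aa[of j i] ij in \<open>auto simp: insert_commute\<close>)
  qed
  moreover have "\<forall>i\<in>{1..r}. \<forall>j\<in>{1..r}. {a i, b j} \<in> E \<longrightarrow> i \<le> j"
    using ba by (meson not_le)
  moreover have "matching E M"
    unfolding matching_def M using ab disj' by blast
  moreover have "M \<noteq> {}" using r by (auto simp: M)
  ultimately show "ordered_matching E M"
    unfolding ordered_matching_def using card M_def by blast
qed

text \<open>A vertex shared by \<open>e i\<close> and \<open>e j\<close> would form, with the other
  end of \<open>e j\<close>, an edge across the two. So \<open>cross\<close> also yields
  disjointness, and with it injectivity.\<close>

lemma induced_matchingI: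
  assumes E: "\<And>e. e \<in> E \<Longrightarrow> card e = 2" and e: "\<And>i. i \<in> I \<Longrightarrow> e i \<in> E"
    and cross: "\<And>i j u v. i \<in> I \<Longrightarrow> j \<in> I \<Longrightarrow> i \<noteq> j \<Longrightarrow> u \<in> e i \<Longrightarrow> v \<in> e j \<Longrightarrow> {u, v} \<notin> E"
  shows "induced_matching E (e ` I)" "card (e ` I) = card I"
proof -
  have disj: "e i \<inter> e j = {}" if ij: "i \<in> I" "j \<in> I" "i \<noteq> j" for i j
  proof (rule ccontr)
    assume "e i \<inter> e j \<noteq> {}"
    then obtain u where u: "u \<in> e i" "u \<in> e j" by blast
    obtain x y where "e j = {x, y}" using E[OF e[OF ij(2)]] by (auto simp: card_2_iff)
    then obtain v where "e j = {u, v}" using u(2) by (metis insert_commute insert_iff singletonD)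
    then show False using cross[OF ij u(1), of v] e[OF ij(2)] by simp
  qed
  have "e i \<noteq> {}" if "i \<in> I" for i using E[OF e[OF that]] by auto
  then have "inj_on e I" using disj by (metis Int_absorb inj_onI)
  then show "card (e ` I) = card I" by (rule card_image)
  have "f \<in> e ` I" if f: "f \<in> E" "f \<subseteq> \<Union>(e ` I)" for f
  proof -
    obtain u v where uv: "f = {u, v}" using E[OF f(1)] by (auto simp: card_2_iff)
    then obtain i j where ij: "i \<in> I" "j \<in> I" "u \<in> e i" "v \<in> e j" using f(2) by blast
    then have "i = j" using cross[OF ij(1,2) _ ij(3,4)] f(1) uv by blast
    then have "f \<subseteq> e i" using uv ij by simp
    moreover have "finite (e i)" using E[OF e[OF ij(1)]] card_ge_0_finite[of "e i"] by simp
    ultimately have "f = e i" using E[OF f(1)] E[OF e[OF ij(1)]] by (simp add: card_subset_eq)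
    then show ?thesis using ij(1) by blast
  qed
  then show "induced_matching E (e ` I)"
    unfolding induced_matching_def matching_def using e disj by blast
qed

section \<open>Matchings in the graphs \<open>Gk_edges k E\<close>\<close>

lemma Gk_edge_iff:
  "{(x, p), (y, q)} \<in> Gk_edges k E \<longleftrightarrow>
    {x, y} \<in> E \<and> p \<in> {1..k} \<and> q \<in> {1..k} \<and> p + q \<le> k + 1"
proof
  assume "{(x, p), (y, q)} \<in> Gk_edges k E"
  then obtain x' y' p' q' where h: "{(x, p), (y, q)} = {(x', p'), (y', q')}" "{x', y'} \<in> E"
      "p' \<in> {1..k}" "q' \<in> {1..k}" "p' + q' \<le> k + 1"
    unfolding Gk_edges_def by blast
  from h(1) have "x = x' \<and> p = p' \<and> y = y' \<and> q = q' \<or> x = y' \<and> p = q' \<and> y = x' \<and> q = p'"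
    by (auto simp: doubleton_eq_iff)
  then show "{x, y} \<in> E \<and> p \<in> {1..k} \<and> q \<in> {1..k} \<and> p + q \<le> k + 1"
    using h(2-5) by (auto simp: insert_commute add.commute)
next
  assume "{x, y} \<in> E \<and> p \<in> {1..k} \<and> q \<in> {1..k} \<and> p + q \<le> k + 1"
  then show "{(x, p), (y, q)} \<in> Gk_edges k E" unfolding Gk_edges_def by blast
qed

lemma fin_simple_graph_Gk:
  assumes "fin_simple_graph V E"
  shows "fin_simple_graph (Gk_verts k V) (Gk_edges k E)"
proof -
  have "e \<subseteq> Gk_verts k V \<and> card e = 2" if e: "e \<in> Gk_edges k E" for e
  proof -
    obtain x y p q where h: "e = {(x, p), (y, q)}" "{x, y} \<in> E" "p \<in> {1..k}" "q \<in> {1..k}"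
      using e unfolding Gk_edges_def by blast
    moreover have "{x, y} \<subseteq> V" "card {x, y} = 2" using h(2) assms by (auto simp: fin_simple_graph_def)
    moreover from this(2) have "x \<noteq> y" by auto
    ultimately show ?thesis by (auto simp: Gk_verts_def)
  qed
  then show ?thesis using assms by (simp add: fin_simple_graph_def Gk_verts_def)
qed

text \<open>For \<open>(v, w)\<close> before \<open>(v', w')\<close> the levels satisfy \<open>lev v \<le> lev v' \<le> lev w' \<le> k + 1 - lev v'\<close>,
  so that the non-edges \<open>{v, v'}\<close> and \<open>{v, w'}\<close> of \<open>G\<^sub>k\<close> project to non-edges of \<open>G\<close>.\<close>

lemma oseq_Gk_ordered_matching:
  assumes E: "\<And>e. e \<in> E \<Longrightarrow> card e = 2"
    and ps: "oseq (Gk_edges k E) snd W ps" "ps \<noteq> []"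
  shows "\<exists>M. ordered_matching E M \<and> card M = length ps"
proof (rule ordered_matchingI[OF E])
  define r where "r = length ps"
  \<comment> \<open>The list is read backwards: in \<open>ps\<close> the first vertex of a pair
    avoids all later pairs, whereas \<open>a i\<close> has to avoid the pairs \<open>j < i\<close>.
    Positions count from 0, so \<open>i\<close> from 1 to \<open>r\<close> visits
    \<open>r - 1\<close> down to 0.\<close>
  define a where "a = (\<lambda>i. fst (fst (ps ! (r - i))))"
  define b where "b = (\<lambda>i. fst (snd (ps ! (r - i))))"
  define p where "p = (\<lambda>i. snd (fst (ps ! (r - i))))"
  define q where "q = (\<lambda>i. snd (snd (ps ! (r - i))))"
  have nth: "ps ! (r - i) = ((a i, p i), (b i, q i))" for i by (simp add: a_def b_def p_def q_def)
  have edge: "{(a i, p i), (b i, q i)} \<in> Gk_edges k E" "p i \<le> q i" if "i \<in> {1..r}" for i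
  proof -
    have "ps ! (r - i) \<in> set ps" using that by (intro nth_mem) (auto simp: r_def)
    then have "((a i, p i), (b i, q i)) \<in> set ps" by (simp add: nth)
    then show "{(a i, p i), (b i, q i)} \<in> Gk_edges k E" "p i \<le> q i" using ps(1) by (fastforce simp: oseq_def)+
  qed
  have pair: "p i \<le> p j" "{(a i, p i), (a j, p j)} \<notin> Gk_edges k E" "{(a i, p i), (b j, q j)} \<notin> Gk_edges k E"
    if "i \<in> {1..r}" "j \<in> {1..r}" "j < i" for i j
  proof -
    have "r - i < r - j" "r - j < length ps" using that by (auto simp: r_def)
    note conjunct2[OF ps(1)[unfolded oseq_def], THEN sorted_wrt_nth_less, OF this]
    then show "p i \<le> p j" "{(a i, p i), (a j, p j)} \<notin> Gk_edges k E" "{(a i, p i), (b j, q j)} \<notin> Gk_edges k E"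
      unfolding nth by simp_all
  qed
  show "1 \<le> length ps" using ps(2) by (simp add: Suc_le_eq)
  show "{a i, b i} \<in> E" if "i \<in> {1..length ps}" for i
    using edge(1)[of i] that by (simp add: Gk_edge_iff r_def)
  show "{a i, a j} \<notin> E" "{a i, b j} \<notin> E" if "i \<in> {1..length ps}" "j \<in> {1..length ps}" "j < i" for i j
  proof -
    have ij: "i \<in> {1..r}" "j \<in> {1..r}" using that by (auto simp: r_def)
    show "{a i, a j} \<notin> E" "{a i, b j} \<notin> E"
      using pair[OF ij that(3)] edge[OF ij(1)] edge[OF ij(2)] by (auto simp: Gk_edge_iff)
  qed
qed

text \<open>The levels \<open>p i\<close> and \<open>q i\<close> sum to exactly
  \<open>k + 1\<close>, so \<open>a i\<close> and \<open>b i\<close> are just adjacent. Two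
  different \<open>b\<close> need a level sum above \<open>k + 1\<close>, and an edge from
  \<open>a i\<close> to \<open>b j\<close> disappears once \<open>q i < q j\<close>. Such an edge
  has \<open>i + s \<le> j\<close>, so \<open>q\<close> may stay constant for
  \<open>i \<le> s\<close>, which raises the smallest levels and weakens the condition on
  \<open>k\<close>.\<close>

lemma s_ordered_matching_induced_Gk:
  assumes G: "fin_simple_graph V E" and s: "1 \<le> s"
    and M: "s_ordered_matching s E M" and r: "r = card M"
    and k: "s = 1 \<Longrightarrow> 2 * r \<le> k + 1" "s \<ge> 2 \<Longrightarrow> 2 * r + 2 \<le> k + 2 * s"
  shows "\<exists>M'. induced_matching (Gk_edges k E) M' \<and> card M' = r"
proof -
  obtain a b where Mr: "M = {{a i, b i} | i. i \<in> {1..r}}" and sr: "s \<le> r"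
    and indep: "independent E (a ` {1..r})"
    and ord: "\<And>i j. i \<in> {1..r} \<Longrightarrow> j \<in> {1..r} \<Longrightarrow> {a i, b j} \<in> E \<Longrightarrow> i = j \<or> int i \<le> int j - int s"
    using M r unfolding s_ordered_matching_def by blast
  have ME: "{a i, b i} \<in> E" if "i \<in> {1..r}" for i
    using M Mr that unfolding s_ordered_matching_def matching_def by blast
  define q where "q = (\<lambda>i. k + max s i - r)"
  define p where "p = (\<lambda>i. k + 1 - q i)"
  \<comment> \<open>Keeps the subtraction in \<open>q\<close> from truncating and all levels
    positive.\<close>
  have kr: "r < k + s" using k s sr by (cases "s = 1") auto
  have q: "1 \<le> q i" "q i \<le> k" "p i + q i = k + 1" if "i \<in> {1..r}" for i
    using kr sr that by (auto simp: q_def p_def)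
  \<comment> \<open>For \<open>s \<ge> 2\<close> the two smallest levels are both
    \<open>k + s - r\<close>; for \<open>s = 1\<close> they are \<open>k + 1 - r\<close> and
    \<open>k + 2 - r\<close>. Hence the two different bounds on \<open>k\<close>.\<close>
  have qq: "k + 1 < q i + q j" if "i \<in> {1..r}" "j \<in> {1..r}" "i \<noteq> j" for i j
    using k s kr sr that by (cases "s = 1") (auto simp: q_def)
  define e where "e = (\<lambda>i. {(a i, p i), (b i, q i)})"
  have card2: "card f = 2" if "f \<in> Gk_edges k E" for f
    using fin_simple_graph_Gk[OF G, of k] that by (simp add: fin_simple_graph_def)
  have edge: "e i \<in> Gk_edges k E" if "i \<in> {1..r}" for i
    using ME[OF that] q[OF that] by (auto simp: e_def Gk_edge_iff)
  have ab: "{(a i, p i), (b j, q j)} \<notin> Gk_edges k E" if ij: "i \<in> {1..r}" "j \<in> {1..r}" "i \<noteq> j" for i j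
  proof
    assume h: "{(a i, p i), (b j, q j)} \<in> Gk_edges k E"
    then have "int i \<le> int j - int s" using ord[OF ij(1,2)] ij(3) by (simp add: Gk_edge_iff)
    \<comment> \<open>From \<open>i + s \<le> j\<close> follow \<open>i < j\<close> and
      \<open>s < j\<close>, so the maximum in \<open>q\<close> strictly increases.\<close>
    then have "q i < q j" using ij s kr sr by (auto simp: q_def)
    then show False using h q(3)[OF ij(1)] by (simp add: Gk_edge_iff)
  qed
  have cross: "{u, v} \<notin> Gk_edges k E"
    if ij: "i \<in> {1..r}" "j \<in> {1..r}" "i \<noteq> j" and uv: "u \<in> e i" "v \<in> e j" for i j u v
  proof -
    have "{a i, a j} \<notin> E" using indep ij by (auto simp: independent_def)
    then have "{(a i, p i), (a j, p j)} \<notin> Gk_edges k E" by (simp add: Gk_edge_iff)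
    moreover have "{(b i, q i), (b j, q j)} \<notin> Gk_edges k E"
      using qq[OF ij] by (simp add: Gk_edge_iff)
    ultimately show ?thesis
      using uv ij ab[of i j] ab[of j i] by (auto simp: e_def insert_commute)
  qed
  have "induced_matching (Gk_edges k E) (e ` {1..r})" "card (e ` {1..r}) = card {1..r}"
    using card2 edge cross by (rule induced_matchingI; blast)+
  then show ?thesis by auto
qed

theorem corollary3p3:
  fixes V :: "'v set" and E :: "'v set set" and s n :: nat
  assumes "fin_simple_graph V E" and "card V = n"
    and "s \<ge> 1"
    and "s_ord_match s E = ereal (real (ord_match E))"
    and "\<And>t. t \<ge> 1 \<Longrightarrow> s_ord_match t E = ereal (real (ord_match E)) \<Longrightarrow> t \<le> s"
  shows "(s = 1 \<longrightarrow>
      (\<forall>k::nat. k \<ge> 1 \<longrightarrow> int k \<ge> 2 * int (ord_match E) - 1 \<longrightarrow>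
        ideal_reg (Gk_verts k V)
            (edge_ideal (Gk_verts k V) (Gk_edges k E) :: ('v \<times> nat, 'k::field) mpoly set)
          = int (ind_match (Gk_edges k E)) + 1 \<and>
        int (ind_match (Gk_edges k E)) + 1 = int (ord_match E) + 1)) \<and>
    (s \<ge> 2 \<longrightarrow>
      (\<forall>k::nat. k \<ge> 1 \<longrightarrow> int k \<ge> 2 * int (ord_match E) - 2 * int s + 2 \<longrightarrow>
        ideal_reg (Gk_verts k V)
            (edge_ideal (Gk_verts k V) (Gk_edges k E) :: ('v \<times> nat, 'k) mpoly set)
          = int (ind_match (Gk_edges k E)) + 1 \<and>
        int (ind_match (Gk_edges k E)) + 1 = int (ord_match E) + 1))"
proof -
  define r where "r = ord_match E"
  have E: "card e = 2" "e \<subseteq> V" if "e \<in> E" for e using assms(1) that by (auto simp: fin_simple_graph_def)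
  have finE: "finite E"
    using assms(1) finite_subset[of E "Pow V"] by (auto simp: fin_simple_graph_def)
  have fin: "finite {card M | M. P M}" if "\<And>M. P M \<Longrightarrow> M \<subseteq> E" for P
    by (rule finite_subset[of _ "card ` Pow E"]) (use that finE in auto)
  let ?S = "{card M | M. s_ordered_matching s E M}"
  \<comment> \<open>The value \<open>ord_match E\<close> is finite, which excludes minus infinity
    for \<open>s_ord_match s E\<close>.\<close>
  have ex: "\<exists>M. s_ordered_matching s E M" and Max: "Max ?S = r"
    using assms(4) by (auto simp: s_ord_match_def r_def split: if_splits)
  have "finite ?S"
    by (rule fin) (simp add: s_ordered_matching_def matching_def)
  then have "Max ?S \<in> ?S" using ex by (intro Max_in) auto
  then obtain M where M: "s_ordered_matching s E M" "r = card M" unfolding Max by blast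
  have "1 \<le> r" using M assms(3) by (auto simp: s_ordered_matching_def)
  have ord_le: "card M' \<le> r" if "ordered_matching E M'" for M'
    unfolding r_def ord_match_def
  proof (rule Max_ge)
    show "finite {card M | M. ordered_matching E M}"
      by (rule fin) (simp add: ordered_matching_def matching_def)
  qed (use that in blast)
  \<comment> \<open>The lower bounds on \<open>k\<close> of the two cases, over the naturals and
    with the subtractions moved to the other side.\<close>
  have main: "ideal_reg (Gk_verts k V)
        (edge_ideal (Gk_verts k V) (Gk_edges k E) :: ('v \<times> nat, 'k::field) mpoly set) = int r + 1
      \<and> ind_match (Gk_edges k E) = r"
    if k: "s = 1 \<Longrightarrow> 2 * r \<le> k + 1" "s \<ge> 2 \<Longrightarrow> 2 * r + 2 \<le> k + 2 * s" for k
  proof -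
    obtain M' where M': "induced_matching (Gk_edges k E) M'" "card M' = r"
      using s_ordered_matching_induced_Gk[OF assms(1,3) M k] by blast
    have "length ps \<le> r" if "oseq (Gk_edges k E) snd (Gk_verts k V) ps" for ps
      using oseq_Gk_ordered_matching[OF E(1) that] ord_le by (cases "ps = []") (simp, metis)
    then show ?thesis
      using reg_edge_ideal_eq[OF fin_simple_graph_Gk[OF assms(1)] _ M' \<open>1 \<le> r\<close>, of snd] by blast
  qed
  show ?thesis
    unfolding r_def[symmetric] using main by (auto simp: r_def)
qed

end
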